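(* Let $(\mathcal{H},\Gamma_0,\Gamma_1)$ be a boundary triplet of $S^*$ which is compatible with the Clifford algebra $\mathcal{C}l_2(J,R)$ (as defined in the context), let $\vec{\alpha}\in\mathbb{S}^2$, and let $A\in\Sigma_{J_{\vec{\alpha}}}$ be the restriction of $S^*$ onto $$\mathcal{D}(A)=\{f\in\mathcal{D}(S^* ): U(\mathcal{J}_{\vec{\alpha}}\Gamma_1+i\Gamma_0)f=(\mathcal{J}_{\vec{\alpha}}\Gamma_1-i\Gamma_0)f\},$$ where $U$ is a unitary operator in $\mathcal{H}$. Let $A_0=S^*\upharpoonright\ker\Gamma_0$. Assume that $A$ is disjoint with $A_0$ (i.e. $\mathcal{D}(A)\cap\mathcal{D}(A_0)=\mathcal{D}(S)$) and $\mu\in\rho(A)\cap\rho(A_0)$. Then $$(A-\mu I)^{-1}=(A_0-\mu I)^{-1}-\gamma(\mu)[M(\mu)-T]^{-1}\gamma^*(\overline{\mu}),$$ where $T=i\mathcal{J}_{\vec{\alpha}}(I+U)(I-U)^{-1}$ is a $\mathcal{J}_{\vec{\alpha}}$-self-adjoint operator in the Krein space $(\mathcal{H},[\cdot,\cdot]_{\mathcal{J}_{\vec{\alpha}}})$.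
   Context: $\mathfrak{H}$ is a complex Hilbert space. A fundamental symmetry is a bounded operator $K$ with $K=K^*$, $K^2=I$; it is non-trivial if $K\neq\pm I$. For a fundamental symmetry $K$ in a Hilbert space, the space endowed with $[\cdot,\cdot]_K=(K\cdot,\cdot)$ is a Krein space, and an operator $A$ is $K$-self-adjoint if $A^*K=KA$ (equivalently $KA^*=AK$). $J$ and $R$ are fixed non-trivial fundamental symmetries in $\mathfrak{H}$ with $JR=-RJ$; $\mathcal{C}l_2(J,R)=\mathrm{span}\{I,J,R,iJR\}$. For $\vec{\alpha}=(\alpha_1,\alpha_2,\alpha_3)\in\mathbb{S}^2\subset\mathbb{R}^3$ put $J_{\vec{\alpha}}=\alpha_1J+\alpha_2R+\alpha_3\,iJR$, a non-trivial fundamental symmetry. $S$ is a closed densely defined symmetric operator in $\mathfrak{H}$ with equal deficiency indices such that $SJ=JS$ and $SR=RS$. $\Sigma_{J_{\vec{\alpha}}}$ is the set of $J_{\vec{\alpha}}$-self-adjoint extensions of $S$. $\rho(\cdot)$ denotes the resolvent set. A boundary triplet of $S^*$ is $(\mathcal{H},\Gamma_0,\Gamma_1)$ with $\mathcal{H}$ a Hilbert space and $\Gamma_0,\Gamma_1:\mathcal{D}(S^* )\to\mathcal{H}$ linear, such that $(S^*x,y)-(x,S^*y)=(\Gamma_1x,\Gamma_0y)_{\mathcal{H}}-(\Gamma_0x,\Gamma_1y)_{\mathcal{H}}$ for all $x,y\in\mathcal{D}(S^* )$ and $(\Gamma_0,\Gamma_1):\mathcal{D}(S^* )\to\mathcal{H}\oplus\mathcal{H}$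 is surjective. The boundary triplet is called compatible if, for some fixed anti-commuting $J_{\vec{\tau}},J_{\vec{\kappa}}\in\mathcal{C}l_2(J,R)$ ($\vec{\tau},\vec{\kappa}\in\mathbb{S}^2$), the formulas $\mathcal{J}_{\vec{\tau}}\Gamma_j=\Gamma_jJ_{\vec{\tau}}$, $\mathcal{J}_{\vec{\kappa}}\Gamma_j=\Gamma_jJ_{\vec{\kappa}}$ ($j=0,1$, on $\mathcal{D}(S^* )$) correctly define anti-commuting fundamental symmetries in $\mathcal{H}$. Then there are anti-commuting fundamental symmetries $\mathcal{J},\mathcal{R}$ in $\mathcal{H}$ with $\mathcal{J}\Gamma_j=\Gamma_jJ$, $\mathcal{R}\Gamma_j=\Gamma_jR$, and for every $\vec{\alpha}\in\mathbb{S}^2$ the fundamental symmetry $\mathcal{J}_{\vec{\alpha}}=\alpha_1\mathcal{J}+\alpha_2\mathcal{R}+\alpha_3\,i\mathcal{J}\mathcal{R}$ in $\mathcal{H}$ satisfies $\mathcal{J}_{\vec{\alpha}}\Gamma_j=\Gamma_jJ_{\vec{\alpha}}$. The displayed formula for $\mathcal{D}(A)$ sets up a bijection between $\Sigma_{J_{\vec{\alpha}}}$ and the unitary operators $U$ in $\mathcal{H}$. $A_0$ is a self-adjoint extension of $S$. For $\mu\in\rho(A_0)$, the $\gamma$-field is $\gamma(\mu)=(\Gamma_0\upharpoonright_{\ker(S^*-\mu I)})^{-1}:\mathcal{H}\to\ker(S^*-\mu I)\subset\mathfrak{H}$, the Weyl function is defined by $M(\mu)\Gamma_0f_\mu=\Gamma_1f_\mu$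 for $f_\mu\in\ker(S^*-\mu I)$, and $\gamma^*(\overline{\mu})=(\gamma(\overline{\mu}))^*$. *)

theory Defs
  imports "HOL-Analysis.Analysis" "HOL-Library.Equipollence"
begin

section \<open>Complex Hilbert spaces\<close>

text \<open>The inner product is linear in its first argument.\<close>

class complex_inner = real_normed_vector +
  fixes scaleC :: "complex \<Rightarrow> 'a \<Rightarrow> 'a" (infixr "*\<^sub>C" 75)
    and cinner :: "'a \<Rightarrow> 'a \<Rightarrow> complex"
  assumes scaleC_add_right: "c *\<^sub>C (x + y) = c *\<^sub>C x + c *\<^sub>C y"
    and scaleC_add_left: "(c + d) *\<^sub>C x = c *\<^sub>C x + d *\<^sub>C x"
    and scaleC_scaleC: "c *\<^sub>C d *\<^sub>C x = (c * d) *\<^sub>C x"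
    and scaleC_of_real: "complex_of_real r *\<^sub>C x = r *\<^sub>R x"
    and cinner_commute: "cinner x y = cnj (cinner y x)"
    and cinner_add_left: "cinner (x + y) z = cinner x z + cinner y z"
    and cinner_scaleC_left: "cinner (c *\<^sub>C x) y = c * cinner x y"
    and cinner_self: "cinner x x = complex_of_real ((norm x)\<^sup>2)"

class complex_hilbert_space = complex_inner + complete_space

instantiation complex :: complex_hilbert_space
begin

definition scaleC_complex :: "complex \<Rightarrow> complex \<Rightarrow> complex"
  where "scaleC_complex c x = c * x"

definition cinner_complex :: "complex \<Rightarrow> complex \<Rightarrow> complex"
  where "cinner_complex x y = x * cnj y"

instance
proof
  fix x :: complex
  show "cinner x x = complex_of_real ((norm x)\<^sup>2)"
    by (simp only: cinner_complex_def complex_norm_square)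
qed (simp_all add: scaleC_complex_def cinner_complex_def algebra_simps scaleR_conv_of_real)

end

definition bounded_clinear :: "('a::complex_inner \<Rightarrow> 'b::complex_inner) \<Rightarrow> bool"
  where "bounded_clinear F \<longleftrightarrow> bounded_linear F \<and> (\<forall>c x. F (c *\<^sub>C x) = c *\<^sub>C F x)"

definition unitary :: "('a::complex_inner \<Rightarrow> 'a) \<Rightarrow> bool"
  where "unitary U \<longleftrightarrow> bounded_clinear U \<and> surj U \<and> (\<forall>x y. cinner (U x) (U y) = cinner x y)"


section \<open>Unbounded operators\<close>

text \<open>
  An unbounded operator is identified with its graph, so that equality of operators includes
  equality of domains; the inverse is the converse relation \<open>A\<inverse>\<close>.
  The operations below make sense for arbitrary linear relations; that a relation is
  (the graph of) a linear operator is expressed by \<open>linear_operator\<close>.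
\<close>

definition op_graph :: "('a \<Rightarrow> 'b) \<Rightarrow> ('a \<times> 'b) set"
  where "op_graph F = {(x, F x) | x. True}"

text \<open>Operator product (the right factor acts first), with its natural domain.\<close>

abbreviation op_comp :: "('b \<times> 'c) set \<Rightarrow> ('a \<times> 'b) set \<Rightarrow> ('a \<times> 'c) set" (infixl "\<odot>" 75)
  where "B \<odot> A \<equiv> A O B"

definition op_minus :: "('a \<times> 'b::minus) set \<Rightarrow> ('a \<times> 'b) set \<Rightarrow> ('a \<times> 'b) set" (infixl "\<ominus>" 65)
  where "A \<ominus> B = {(x, y - z) | x y z. (x, y) \<in> A \<and> (x, z) \<in> B}"

definition linear_operator :: "('a::complex_inner \<times> 'b::complex_inner) set \<Rightarrow> bool"
  where "linear_operator A \<longleftrightarrow> single_valued A \<and> (0, 0) \<in> A \<and>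
    (\<forall>x y x' y'. (x, y) \<in> A \<longrightarrow> (x', y') \<in> A \<longrightarrow> (x + x', y + y') \<in> A) \<and>
    (\<forall>c x y. (x, y) \<in> A \<longrightarrow> (c *\<^sub>C x, c *\<^sub>C y) \<in> A)"

definition densely_defined :: "('a::complex_inner \<times> 'b) set \<Rightarrow> bool"
  where "densely_defined A \<longleftrightarrow> closure (Domain A) = UNIV"

definition adjoint_op :: "('a::complex_inner \<times> 'b::complex_inner) set \<Rightarrow> ('b \<times> 'a) set"
  where "adjoint_op A = {(y, z). \<forall>(x, w) \<in> A. cinner w y = cinner x z}"

definition symmetric_op :: "('a::complex_inner \<times> 'a) set \<Rightarrow> bool"
  where "symmetric_op S \<longleftrightarrow> S \<subseteq> adjoint_op S"

definition resolvent :: "('a::complex_inner \<times> 'a) set \<Rightarrow> complex \<Rightarrow> ('a \<times> 'a) set"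
  where "resolvent A \<mu> = (A \<ominus> op_graph (\<lambda>x. \<mu> *\<^sub>C x))\<inverse>"

definition resolvent_set :: "('a::complex_inner \<times> 'a) set \<Rightarrow> complex set"
  where "resolvent_set A = {\<mu>. \<exists>F. bounded_clinear F \<and> resolvent A \<mu> = op_graph F}"

text \<open>For \<open>A = adjoint_op S\<close> this is the kernel of \<open>S\<^sup>* - \<mu>I\<close>.\<close>

definition eigenspace :: "('a::complex_inner \<times> 'a) set \<Rightarrow> complex \<Rightarrow> 'a set"
  where "eigenspace A \<mu> = {f. (f, \<mu> *\<^sub>C f) \<in> A}"

text \<open>Complete orthonormal system of a closed subspace \<open>M\<close> of a Hilbert space.\<close>

definition orthonormal_basis_of :: "'a::complex_inner set \<Rightarrow> 'a set \<Rightarrow> bool"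
  where "orthonormal_basis_of M B \<longleftrightarrow> B \<subseteq> M \<and>
    (\<forall>b\<in>B. \<forall>c\<in>B. cinner b c = (if b = c then 1 else 0)) \<and>
    (\<forall>x\<in>M. (\<forall>b\<in>B. cinner x b = 0) \<longrightarrow> x = 0)"

text \<open>Equality of Hilbert dimensions, as (possibly uncountable) cardinals.\<close>

definition equal_hilbert_dim :: "'a::complex_inner set \<Rightarrow> 'a set \<Rightarrow> bool"
  where "equal_hilbert_dim M N \<longleftrightarrow>
    (\<exists>B C. orthonormal_basis_of M B \<and> orthonormal_basis_of N C \<and> B \<approx> C)"

definition equal_deficiency_indices :: "('a::complex_inner \<times> 'a) set \<Rightarrow> bool"
  where "equal_deficiency_indices S \<longleftrightarrow>
    equal_hilbert_dim (eigenspace (adjoint_op S) \<i>) (eigenspace (adjoint_op S) (- \<i>))"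


section \<open>Fundamental symmetries and Krein space self-adjointness\<close>

definition fundamental_symmetry :: "('a::complex_inner \<Rightarrow> 'a) \<Rightarrow> bool"
  where "fundamental_symmetry K \<longleftrightarrow> bounded_clinear K \<and>
    (\<forall>x y. cinner (K x) y = cinner x (K y)) \<and> (\<forall>x. K (K x) = x)"

definition nontrivial_symmetry :: "('a::complex_inner \<Rightarrow> 'a) \<Rightarrow> bool"
  where "nontrivial_symmetry K \<longleftrightarrow> fundamental_symmetry K \<and> K \<noteq> (\<lambda>x. x) \<and> K \<noteq> (\<lambda>x. - x)"

definition anticommuting :: "('a::complex_inner \<Rightarrow> 'a) \<Rightarrow> ('a \<Rightarrow> 'a) \<Rightarrow> bool"
  where "anticommuting J R \<longleftrightarrow> (\<forall>x. J (R x) = - R (J x))"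

text \<open>\<open>A\<close> is self-adjoint in the Krein space with indefinite inner product \<open>(K\<cdot>,\<cdot>)\<close>.\<close>

definition krein_self_adjoint :: "('a::complex_inner \<Rightarrow> 'a) \<Rightarrow> ('a \<times> 'a) set \<Rightarrow> bool"
  where "krein_self_adjoint K A \<longleftrightarrow> fundamental_symmetry K \<and>
    linear_operator A \<and> densely_defined A \<and>
    adjoint_op A \<odot> op_graph K = op_graph K \<odot> A"

definition krein_extensions :: "('a::complex_inner \<Rightarrow> 'a) \<Rightarrow> ('a \<times> 'a) set \<Rightarrow> ('a \<times> 'a) set set"
  where "krein_extensions K S = {A. S \<subseteq> A \<and> krein_self_adjoint K A}"

definition clifford_symmetry ::
    "('a::complex_inner \<Rightarrow> 'a) \<Rightarrow> ('a \<Rightarrow> 'a) \<Rightarrow> real^3 \<Rightarrow> 'a \<Rightarrow> 'a"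
  where "clifford_symmetry J R \<alpha> =
    (\<lambda>x. \<alpha>$1 *\<^sub>R J x + \<alpha>$2 *\<^sub>R R x + \<alpha>$3 *\<^sub>R (\<i> *\<^sub>C J (R x)))"


section \<open>Boundary triplets\<close>

text \<open>
  The boundary maps are total functions of which only the values on
  \<open>Domain (adjoint_op S)\<close> matter; the auxiliary Hilbert space is the whole type \<open>'h\<close>.
\<close>

definition boundary_triplet ::
    "('a::complex_hilbert_space \<times> 'a) set \<Rightarrow> ('a \<Rightarrow> 'h::complex_hilbert_space) \<Rightarrow> ('a \<Rightarrow> 'h) \<Rightarrow> bool"
  where "boundary_triplet S \<Gamma>\<^sub>0 \<Gamma>\<^sub>1 \<longleftrightarrow>
    (\<forall>\<Gamma>\<in>{\<Gamma>\<^sub>0, \<Gamma>\<^sub>1}.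
      (\<forall>f\<in>Domain (adjoint_op S). \<forall>g\<in>Domain (adjoint_op S). \<Gamma> (f + g) = \<Gamma> f + \<Gamma> g) \<and>
      (\<forall>c. \<forall>f\<in>Domain (adjoint_op S). \<Gamma> (c *\<^sub>C f) = c *\<^sub>C \<Gamma> f)) \<and>
    (\<forall>(x, x')\<in>adjoint_op S. \<forall>(y, y')\<in>adjoint_op S.
      cinner x' y - cinner x y' = cinner (\<Gamma>\<^sub>1 x) (\<Gamma>\<^sub>0 y) - cinner (\<Gamma>\<^sub>0 x) (\<Gamma>\<^sub>1 y)) \<and>
    (\<forall>u v. \<exists>f\<in>Domain (adjoint_op S). \<Gamma>\<^sub>0 f = u \<and> \<Gamma>\<^sub>1 f = v)"

definition intertwines ::
    "('a::complex_inner \<times> 'a) set \<Rightarrow> ('a \<Rightarrow> 'h) \<Rightarrow> ('a \<Rightarrow> 'h) \<Rightarrow> ('a \<Rightarrow> 'a) \<Rightarrow> ('h \<Rightarrow> 'h) \<Rightarrow> bool"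
  where "intertwines S \<Gamma>\<^sub>0 \<Gamma>\<^sub>1 K L \<longleftrightarrow>
    (\<forall>f\<in>Domain (adjoint_op S). L (\<Gamma>\<^sub>0 f) = \<Gamma>\<^sub>0 (K f) \<and> L (\<Gamma>\<^sub>1 f) = \<Gamma>\<^sub>1 (K f))"

definition compatible_triplet ::
    "('a::complex_hilbert_space \<Rightarrow> 'a) \<Rightarrow> ('a \<Rightarrow> 'a) \<Rightarrow> ('a \<times> 'a) set \<Rightarrow>
      ('a \<Rightarrow> 'h::complex_hilbert_space) \<Rightarrow> ('a \<Rightarrow> 'h) \<Rightarrow> bool"
  where "compatible_triplet J R S \<Gamma>\<^sub>0 \<Gamma>\<^sub>1 \<longleftrightarrow>
    (\<exists>\<tau> \<kappa> L\<^sub>\<tau> L\<^sub>\<kappa>. \<tau> \<in> sphere 0 1 \<and> \<kappa> \<in> sphere 0 1 \<and>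
      anticommuting (clifford_symmetry J R \<tau>) (clifford_symmetry J R \<kappa>) \<and>
      fundamental_symmetry L\<^sub>\<tau> \<and> fundamental_symmetry L\<^sub>\<kappa> \<and> anticommuting L\<^sub>\<tau> L\<^sub>\<kappa> \<and>
      intertwines S \<Gamma>\<^sub>0 \<Gamma>\<^sub>1 (clifford_symmetry J R \<tau>) L\<^sub>\<tau> \<and>
      intertwines S \<Gamma>\<^sub>0 \<Gamma>\<^sub>1 (clifford_symmetry J R \<kappa>) L\<^sub>\<kappa>)"

text \<open>
  The fundamental symmetry of the boundary space induced by \<open>K\<close>. It is unique because
  \<open>\<Gamma>\<^sub>0\<close> is surjective; for \<open>K\<close> equal to \<open>J\<close> or \<open>R\<close> it exists when the triplet is compatible.
\<close>

definition boundary_symmetry ::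
    "('a::complex_hilbert_space \<times> 'a) set \<Rightarrow> ('a \<Rightarrow> 'h::complex_hilbert_space) \<Rightarrow> ('a \<Rightarrow> 'h) \<Rightarrow>
      ('a \<Rightarrow> 'a) \<Rightarrow> 'h \<Rightarrow> 'h"
  where "boundary_symmetry S \<Gamma>\<^sub>0 \<Gamma>\<^sub>1 K =
    (THE L. fundamental_symmetry L \<and> intertwines S \<Gamma>\<^sub>0 \<Gamma>\<^sub>1 K L)"

definition gamma_field ::
    "('a::complex_inner \<times> 'a) set \<Rightarrow> ('a \<Rightarrow> 'h) \<Rightarrow> complex \<Rightarrow> ('h \<times> 'a) set"
  where "gamma_field S \<Gamma>\<^sub>0 \<mu> = {(f, \<Gamma>\<^sub>0 f) | f. f \<in> eigenspace (adjoint_op S) \<mu>}\<inverse>"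

definition weyl_function ::
    "('a::complex_inner \<times> 'a) set \<Rightarrow> ('a \<Rightarrow> 'h) \<Rightarrow> ('a \<Rightarrow> 'h) \<Rightarrow> complex \<Rightarrow> ('h \<times> 'h) set"
  where "weyl_function S \<Gamma>\<^sub>0 \<Gamma>\<^sub>1 \<mu> = {(\<Gamma>\<^sub>0 f, \<Gamma>\<^sub>1 f) | f. f \<in> eigenspace (adjoint_op S) \<mu>}"

end

theory Submission
  imports Defs
begin

text \<open>
  The operator \<open>\<J>\<^sub>\<alpha> T\<close> is the Cayley transform \<open>\<i>(I + U)(I - U)\<inverse>\<close>, and disjointness of \<open>A\<close> and
  \<open>A\<^sub>0\<close> says exactly that \<open>U\<close> has no non-zero fixed vector, so \<open>T\<close> is \<open>\<J>\<^sub>\<alpha>\<close>-self-adjoint; moreover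
  \<open>k \<in> D(A)\<close> iff \<open>\<Gamma>\<^sub>1 k = T \<Gamma>\<^sub>0 k\<close>. Green's identity gives \<open>\<gamma>(\<mu>\<^sup>c)\<^sup>* = \<Gamma>\<^sub>1 (A\<^sub>0 - \<mu>)\<inverse>\<close>, with \<open>\<mu>\<^sup>c\<close> the
  conjugate of \<open>\<mu>\<close>. For \<open>h = (A\<^sub>0 - \<mu>)\<inverse> y\<close> and \<open>k = (A - \<mu>)\<inverse> y\<close> the vector \<open>h - k\<close> lies in
  \<open>ker (S\<^sup>* - \<mu>)\<close> and \<open>(M(\<mu>) - T) \<Gamma>\<^sub>0 (h - k) = \<Gamma>\<^sub>1 h\<close>, which is the formula. The adjoint of the
  \<open>\<gamma>\<close>-field is single-valued because \<open>\<Gamma>\<^sub>0\<close> maps \<open>ker (S\<^sup>* - \<mu>\<^sup>c)\<close> onto a dense set: a vector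
  orthogonal to that image is \<open>\<Gamma>\<^sub>1 h\<close> for some \<open>h \<in> D(A\<^sub>0)\<close> with \<open>(A\<^sub>0 - \<mu>) h\<close> in the closed
  range of \<open>S - \<mu>\<close>, whence \<open>h \<in> D(S)\<close> and \<open>\<Gamma>\<^sub>1 h = 0\<close>.
\<close>

section \<open>Complex inner product spaces and orthogonal projection\<close>

text \<open>The class axioms contain no unit law, so it is derived from
  \<open>scaleC_of_real\<close>. The interpretation brings in the distributivity rules of vector
  spaces for \<open>scaleC\<close>.\<close>

interpretation scaleC: vector_space "scaleC :: complex \<Rightarrow> 'a::complex_inner \<Rightarrow> 'a"
proof
  show "1 *\<^sub>C x = x" for x :: 'a
    using scaleC_of_real[of 1 x] by simp
qed (simp_all add: scaleC_add_right scaleC_add_left scaleC_scaleC)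

lemma norm_scaleC: "norm (c *\<^sub>C x) = cmod c * norm (x::'a::complex_inner)"
proof -
  have "cinner (c *\<^sub>C x) (c *\<^sub>C x) = c * cnj (c * cinner x x)"
    by (metis cinner_scaleC_left cinner_commute)
  then have "complex_of_real ((norm (c *\<^sub>C x))\<^sup>2) = complex_of_real ((cmod c * norm x)\<^sup>2)"
    by (simp add: cinner_self power_mult_distrib complex_norm_square mult.assoc flip: of_real_power)
  then show ?thesis
    by (metis of_real_eq_iff norm_ge_zero mult_nonneg_nonneg power2_eq_imp_eq)
qed

lemma cinner_add_right: "cinner x (y + z) = cinner x y + cinner x (z::'a::complex_inner)"
  by (metis cinner_add_left cinner_commute complex_cnj_add)

lemma cinner_scaleC_right: "cinner x (c *\<^sub>C y) = cnj c * cinner x (y::'a::complex_inner)"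
  by (metis cinner_scaleC_left cinner_commute complex_cnj_mult)

lemma cinner_zero_left [simp]: "cinner 0 (y::'a::complex_inner) = 0"
  using cinner_scaleC_left[of 0 0 y] by simp

lemma cinner_zero_right [simp]: "cinner (x::'a::complex_inner) 0 = 0"
  by (metis cinner_zero_left cinner_commute complex_cnj_zero)

lemma cinner_minus_left: "cinner (- x) (y::'a::complex_inner) = - cinner x y"
  using cinner_add_left[of x "- x" y] by (simp add: eq_neg_iff_add_eq_0 add.commute)

lemma cinner_minus_right: "cinner (x::'a::complex_inner) (- y) = - cinner x y"
  by (metis cinner_minus_left cinner_commute complex_cnj_minus)

lemma cinner_diff_left: "cinner (x - y) (z::'a::complex_inner) = cinner x z - cinner y z"
  by (simp only: diff_conv_add_uminus cinner_add_left cinner_minus_left)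

lemma cinner_diff_right: "cinner x (y - z) = cinner x y - cinner x (z::'a::complex_inner)"
  by (simp only: diff_conv_add_uminus cinner_add_right cinner_minus_right)

lemma cinner_self_eq_0_iff: "cinner x x = 0 \<longleftrightarrow> x = (0::'a::complex_inner)"
  by (simp add: cinner_self)

lemma cinner_left_eqI:
  assumes "\<And>z. cinner z x = cinner z (y::'a::complex_inner)"
  shows "x = y"
  using assms[of "x - y"] cinner_self_eq_0_iff[of "x - y"] by (simp add: cinner_diff_right)

lemmas cinner_simps =
  cinner_add_left cinner_add_right cinner_diff_left cinner_diff_right
  cinner_minus_left cinner_minus_right cinner_scaleC_left cinner_scaleC_right

lemma norm_diff_square:
  "(norm (x - y))\<^sup>2 = (norm x)\<^sup>2 - 2 * Re (cinner x y) + (norm (y::'a::complex_inner))\<^sup>2"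
proof -
  have "complex_of_real ((norm (x - y))\<^sup>2) = cinner (x - y) (x - y)"
    by (simp only: cinner_self)
  also have "\<dots> = cinner x x - (cinner x y + cnj (cinner x y)) + cinner y y"
    using cinner_commute[of y x] by (simp add: cinner_simps)
  also have "\<dots> = complex_of_real ((norm x)\<^sup>2 - 2 * Re (cinner x y) + (norm y)\<^sup>2)"
    by (simp add: complex_add_cnj cinner_self)
  finally show ?thesis
    using of_real_eq_iff by blast
qed

section \<open>Orthogonality and projection onto the closure of a subspace\<close>

lemma parallelogram_law:
  "(norm (x + y))\<^sup>2 + (norm (x - y))\<^sup>2 = 2 * (norm x)\<^sup>2 + 2 * (norm (y::'a::complex_inner))\<^sup>2"
  using norm_diff_square[of x y] norm_diff_square[of x "- y"] by (simp add: cinner_minus_right)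

text \<open>Closedness is kept out of this notion: projections land in \<open>closure V\<close>, and
  the range of \<open>S - \<mu>\<close> is used as a subspace before its closedness is
  invoked.\<close>

definition csubspace :: "'a::complex_inner set \<Rightarrow> bool"
  where "csubspace V \<longleftrightarrow> 0 \<in> V \<and> (\<forall>x\<in>V. \<forall>y\<in>V. x + y \<in> V) \<and> (\<forall>c. \<forall>x\<in>V. c *\<^sub>C x \<in> V)"

lemma csubspaceD:
  assumes "csubspace V"
  shows "0 \<in> V" "x \<in> V \<Longrightarrow> y \<in> V \<Longrightarrow> x + y \<in> V" "x \<in> V \<Longrightarrow> c *\<^sub>C x \<in> V"
  using assms by (auto simp: csubspace_def)

text \<open>If the inner product were non-zero, subtracting a suitable multiple of \<open>v\<close>
  would lower the squared norm of \<open>q\<close> by at least |(q,v)|^2 / n.\<close>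

lemma orthogonal_if_minimal:
  fixes q v :: "'a::complex_inner"
  assumes min: "\<And>c. norm q \<le> norm (q - c *\<^sub>C v)"
  shows "cinner q v = 0"
proof (rule ccontr)
  assume "cinner q v \<noteq> 0"
  then have nz: "cmod (cinner q v) > 0" by simp
  \<comment> \<open>The added 1 keeps the divisor positive even for \<open>v = 0\<close>.\<close>
  define n where "n = (norm v)\<^sup>2 + 1"
  have n: "n > 0" "(norm v)\<^sup>2 < n" by (auto simp: n_def add_nonneg_pos)
  define c where "c = cinner q v / complex_of_real n"
  have inner: "cinner q (c *\<^sub>C v) = complex_of_real ((cmod (cinner q v))\<^sup>2 / n)"
    using complex_norm_square[of "cinner q v"]
    by (simp add: cinner_scaleC_right c_def mult.commute)
  have "(norm q)\<^sup>2 \<le> (norm (q - c *\<^sub>C v))\<^sup>2"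
    by (intro power_mono min norm_ge_zero)
  also have "\<dots> = (norm q)\<^sup>2 - 2 * ((cmod (cinner q v))\<^sup>2 / n) + (cmod c)\<^sup>2 * (norm v)\<^sup>2"
    by (simp add: norm_diff_square inner norm_scaleC power_mult_distrib)
  also have "(cmod c)\<^sup>2 * (norm v)\<^sup>2 \<le> (cmod c)\<^sup>2 * n"
    using n by (intro mult_left_mono) auto
  also have "(cmod c)\<^sup>2 * n = (cmod (cinner q v))\<^sup>2 / n"
    using n by (simp add: c_def norm_divide power_divide power2_eq_square field_simps)
  finally have "(cmod (cinner q v))\<^sup>2 / n \<le> 0" by simp
  with nz n show False by (simp add: divide_le_0_iff)
qed

text \<open>A minimizing sequence for the distance from \<open>x\<close> to \<open>V\<close> is
  Cauchy by the parallelogram law. Its limit attains the distance, and this minimality forces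
  orthogonality.\<close>

lemma projection_exists:
  fixes x :: "'a::complex_hilbert_space"
  assumes V: "csubspace V"
  obtains p where "p \<in> closure V" "\<And>v. v \<in> V \<Longrightarrow> cinner (x - p) v = 0"
proof -
  define d where "d = infdist x V"
  have ne: "V \<noteq> {}" using csubspaceD(1)[OF V] by blast
  have d_le: "d \<le> norm (x - v)" if "v \<in> V" for v
    using infdist_le[OF that, of x] by (simp add: d_def dist_norm)
  have d0: "0 \<le> d" by (simp add: d_def infdist_nonneg)
  have "\<exists>v\<in>V. norm (x - v) < d + 1 / Suc n" for n
  proof (rule ccontr)
    assume "\<not> ?thesis"
    then have "d + 1 / Suc n \<le> infdist x V"
      unfolding infdist_notempty[OF ne] by (intro cINF_greatest ne) (auto simp: dist_norm not_less)
    then show False by (simp add: d_def)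
  qed
  then obtain v where v: "v n \<in> V" "norm (x - v n) < d + 1 / Suc n" for n
    by metis
  have lim: "(\<lambda>n. norm (x - v n)) \<longlonglongrightarrow> d"
  proof (rule tendsto_sandwich[of "\<lambda>n. d" _ _ "\<lambda>n. d + 1 / Suc n"])
    show "(\<lambda>n. d + 1 / real (Suc n)) \<longlonglongrightarrow> d"
      using tendsto_add[OF tendsto_const[of d] LIMSEQ_Suc[OF lim_1_over_n]] by simp
  qed (use v d_le in \<open>auto intro!: always_eventually less_imp_le\<close>)
  \<comment> \<open>The midpoint of \<open>v m\<close> and \<open>v n\<close> lies in
    \<open>V\<close>, hence at distance at least \<open>d\<close> from \<open>x\<close>; the
    parallelogram law then bounds the gap.\<close>
  have close: "(norm (v m - v n))\<^sup>2 \<le> 2 * (norm (x - v m))\<^sup>2 + 2 * (norm (x - v n))\<^sup>2 - 4 * d\<^sup>2" for m n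
  proof -
    define w where "w = (1/2::complex) *\<^sub>C (v m + v n)"
    have "w \<in> V" using v(1) by (auto simp: w_def intro!: csubspaceD[OF V])
    then have "d\<^sup>2 \<le> (norm (x - w))\<^sup>2" using d_le d0 by (intro power_mono) auto
    moreover have "(x - v m) + (x - v n) = 2 *\<^sub>R (x - w)"
      using scaleC_of_real[of "1/2" "v m + v n"]
      by (simp add: w_def scaleR_2 algebra_simps flip: scaleR_add_right)
    then have "(norm ((x - v m) + (x - v n)))\<^sup>2 = 4 * (norm (x - w))\<^sup>2"
      by (simp add: power_mult_distrib)
    ultimately show ?thesis
      using parallelogram_law[of "x - v m" "x - v n"] by (simp add: norm_minus_commute)
  qed
  have "Cauchy v"
  proof (rule metric_CauchyI)
    fix e :: real assume e: "0 < e"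
    have "(\<lambda>n. (norm (x - v n))\<^sup>2) \<longlonglongrightarrow> d\<^sup>2" by (intro tendsto_power lim)
    then have "\<forall>\<^sub>F n in sequentially. (norm (x - v n))\<^sup>2 < d\<^sup>2 + e\<^sup>2 / 4"
      using e by (intro order_tendstoD(2)) auto
    then obtain N where N: "\<And>n. n \<ge> N \<Longrightarrow> (norm (x - v n))\<^sup>2 < d\<^sup>2 + e\<^sup>2 / 4"
      by (auto simp: eventually_sequentially)
    have "dist (v m) (v n) < e" if "m \<ge> N" "n \<ge> N" for m n
    proof -
      have "(norm (v m - v n))\<^sup>2 < e\<^sup>2" using close[of m n] N[OF that(1)] N[OF that(2)] by simp
      then show ?thesis using e power_less_imp_less_base[of _ 2 e] by (simp add: dist_norm)
    qed
    then show "\<exists>M. \<forall>m\<ge>M. \<forall>n\<ge>M. dist (v m) (v n) < e" by blast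
  qed
  then obtain p where p: "v \<longlonglongrightarrow> p"
    using Cauchy_convergent convergent_def by blast
  have norm_p: "norm (x - p) = d"
    using LIMSEQ_unique[OF tendsto_norm[OF tendsto_diff[OF tendsto_const p]] lim] .
  show ?thesis
  proof
    show "p \<in> closure V" using p v(1) by (auto simp: closure_sequential)
    fix u assume u: "u \<in> V"
    show "cinner (x - p) u = 0"
    proof (rule orthogonal_if_minimal)
      fix c
      \<comment> \<open>Each \<open>v n + c *\<^sub>C u\<close> lies in \<open>V\<close>, so the
        lower bound \<open>d\<close> survives in the limit.\<close>
      have "(\<lambda>n. norm (x - v n - c *\<^sub>C u)) \<longlonglongrightarrow> norm (x - p - c *\<^sub>C u)"
        by (intro tendsto_intros p)
      moreover have "d \<le> norm (x - v n - c *\<^sub>C u)" for n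
        using d_le[of "v n + c *\<^sub>C u"] v(1) u csubspaceD[OF V] by (simp add: diff_diff_eq)
      ultimately show "norm (x - p) \<le> norm (x - p - c *\<^sub>C u)"
        unfolding norm_p by (intro LIMSEQ_le_const) auto
    qed
  qed
qed

lemma bounded_linear_scaleC: "bounded_linear (\<lambda>x. c *\<^sub>C (x::'a::complex_inner))"
proof (rule bounded_linear_intro)
  show "c *\<^sub>C (r *\<^sub>R x) = r *\<^sub>R (c *\<^sub>C x)" for r and x :: 'a
    by (simp flip: scaleC_of_real add: mult.commute)
  show "norm (c *\<^sub>C x) \<le> norm x * cmod c" for x :: 'a
    by (simp add: norm_scaleC)
qed (rule scaleC_add_right)

text \<open>Orthogonality to \<open>v\<close> gives norm q \<le> norm (q - c v) by Pythagoras. This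
  inequality passes to limits, and \<open>orthogonal_if_minimal\<close> turns it back into
  orthogonality.\<close>

lemma orthogonal_closure:
  fixes q :: "'a::complex_inner"
  assumes "p \<in> closure V" "\<And>v. v \<in> V \<Longrightarrow> cinner q v = 0"
  shows "cinner q p = 0"
proof (rule orthogonal_if_minimal)
  fix c
  obtain v where v: "\<And>n. v n \<in> V" "v \<longlonglongrightarrow> p" using assms(1) by (auto simp: closure_sequential)
  have "(\<lambda>n. norm (q - c *\<^sub>C v n)) \<longlonglongrightarrow> norm (q - c *\<^sub>C p)"
    by (intro tendsto_norm tendsto_diff tendsto_const bounded_linear.tendsto[OF bounded_linear_scaleC v(2)])
  moreover have "norm q \<le> norm (q - c *\<^sub>C v n)" for n
  proof (rule power2_le_imp_le)
    show "(norm q)\<^sup>2 \<le> (norm (q - c *\<^sub>C v n))\<^sup>2"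
      by (simp add: norm_diff_square cinner_scaleC_right assms(2) v)
  qed simp
  ultimately show "norm q \<le> norm (q - c *\<^sub>C p)" by (intro LIMSEQ_le_const) auto
qed

text \<open>The residual \<open>x - p\<close> of the projection is orthogonal to \<open>V\<close>,
  thus to \<open>x\<close> by hypothesis and to \<open>p\<close> by
  \<open>orthogonal_closure\<close>, thus to itself. This is the double orthogonal complement
  argument.\<close>

lemma in_closure_if_orthogonal:
  fixes x :: "'a::complex_hilbert_space"
  assumes V: "csubspace V"
    and orth: "\<And>q. (\<And>v. v \<in> V \<Longrightarrow> cinner q v = 0) \<Longrightarrow> cinner q x = 0"
  shows "x \<in> closure V"
proof -
  obtain p where p: "p \<in> closure V" "\<And>v. v \<in> V \<Longrightarrow> cinner (x - p) v = 0"
    using projection_exists[OF V] by blast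
  have "cinner (x - p) (x - p) = 0"
    using orth[of "x - p"] orthogonal_closure[of p V "x - p"] p by (simp add: cinner_diff_right)
  then have "x = p" by (simp add: cinner_self_eq_0_iff)
  with p(1) show ?thesis by simp
qed

section \<open>Clifford algebra generated by two anti-commuting symmetries\<close>

lemma bounded_clinearD:
  assumes "bounded_clinear F"
  shows "bounded_linear F" "F (x + y) = F x + F y" "F (x - y) = F x - F y" "F (- x) = - F x"
    "F 0 = 0" "F (c *\<^sub>C x) = c *\<^sub>C F x" "F (r *\<^sub>R x) = r *\<^sub>R F x"
proof -
  have l: "bounded_linear F" using assms by (simp add: bounded_clinear_def)
  note linear = bounded_linear.linear[OF l]
  show "bounded_linear F" by (rule l)
  show "F (x + y) = F x + F y" "F (x - y) = F x - F y" "F (- x) = - F x" "F 0 = 0"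
    "F (r *\<^sub>R x) = r *\<^sub>R F x"
    using linear by (simp_all add: linear_add linear_diff linear_neg linear_0 linear_scale)
  show "F (c *\<^sub>C x) = c *\<^sub>C F x" using assms by (simp add: bounded_clinear_def)
qed

lemma fundamental_symmetryD:
  assumes "fundamental_symmetry K"
  shows "bounded_clinear K" "cinner (K x) y = cinner x (K y)" "K (K x) = x"
  using assms by (auto simp: fundamental_symmetry_def)

lemmas fundamental_symmetry_linear = bounded_clinearD[OF fundamental_symmetryD(1)]

lemma scaleR_scaleC_commute: "r *\<^sub>R (c *\<^sub>C x) = c *\<^sub>C (r *\<^sub>R (x::'a::complex_inner))"
  by (simp flip: scaleC_of_real add: mult.commute)

text \<open>The residual \<open>v\<close> is orthogonal to all three vectors. Orthogonality to
  \<tau> and \<kappa> makes its cross product with \<nu> vanish, while orthogonality to the unit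
  vector \<nu> gives that product the norm of \<open>v\<close>.\<close>

lemma orthonormal_frame_expansion:
  fixes \<tau> \<kappa> \<alpha> :: "real^3"
  assumes "\<tau> \<in> sphere 0 1" "\<kappa> \<in> sphere 0 1" "\<tau> \<bullet> \<kappa> = 0"
  defines "\<nu> \<equiv> cross3 \<tau> \<kappa>"
  shows "(\<tau> \<bullet> \<alpha>) *\<^sub>R \<tau> + (\<kappa> \<bullet> \<alpha>) *\<^sub>R \<kappa> + (\<nu> \<bullet> \<alpha>) *\<^sub>R \<nu> = \<alpha>"
proof -
  have unit: "\<tau> \<bullet> \<tau> = 1" "\<kappa> \<bullet> \<kappa> = 1" using assms(1,2) by (simp_all add: dot_square_norm)
  have \<nu>: "\<nu> \<bullet> \<nu> = 1" "\<tau> \<bullet> \<nu> = 0" "\<kappa> \<bullet> \<nu> = 0"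
    using unit assms(3) by (simp_all add: \<nu>_def dot_cross inner_commute dot_cross_self)
  define v where "v = \<alpha> - ((\<tau> \<bullet> \<alpha>) *\<^sub>R \<tau> + (\<kappa> \<bullet> \<alpha>) *\<^sub>R \<kappa> + (\<nu> \<bullet> \<alpha>) *\<^sub>R \<nu>)"
  have orth: "v \<bullet> \<tau> = 0" "v \<bullet> \<kappa> = 0" "v \<bullet> \<nu> = 0"
    using unit \<nu> assms(3)
    by (simp_all add: v_def inner_diff_left inner_add_left inner_diff_right inner_add_right inner_commute)
  have "cross3 v \<nu> = 0" by (simp add: \<nu>_def Lagrange orth)
  then have "v = 0"
    using norm_cross[of v \<nu>] orth(3) \<nu>(1) by (simp flip: dot_square_norm)
  then show ?thesis by (simp add: v_def)
qed

lemma clifford_symmetry_vec_linear: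
  "clifford_symmetry J R (a *\<^sub>R \<tau> + b *\<^sub>R \<kappa> + c *\<^sub>R \<nu>) x =
    a *\<^sub>R clifford_symmetry J R \<tau> x + b *\<^sub>R clifford_symmetry J R \<kappa> x
      + c *\<^sub>R clifford_symmetry J R \<nu> x"
  by (simp add: clifford_symmetry_def algebra_simps)

text \<open>Lets \<open>J\<close> and \<open>R\<close> be treated as members of the family indexed
  by the sphere.\<close>

lemma clifford_symmetry_axis:
  "clifford_symmetry J R (axis 1 1) = J" "clifford_symmetry J R (axis 2 1) = R"
  by (simp_all add: clifford_symmetry_def axis_def)

text \<open>Interpreted three times: for \<open>J\<close>, \<open>R\<close>, for the pair supplied
  by compatibility in the boundary space, and for the boundary symmetries induced by
  \<open>J\<close> and \<open>R\<close>.\<close>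

locale clifford_pair =
  fixes J R :: "'a::complex_inner \<Rightarrow> 'a"
  assumes J: "fundamental_symmetry J" and R: "fundamental_symmetry R"
    and anti: "anticommuting J R"
begin

lemma RJ: "R (J x) = - J (R x)"
  using anti by (simp add: anticommuting_def)

text \<open>The Pauli relation: up to orientation, \<open>J\<close>, \<open>R\<close> and \<open>iJR\<close> are the Pauli matrices.\<close>

lemma clifford_symmetry_product:
  "clifford_symmetry J R \<tau> (clifford_symmetry J R \<kappa> x) =
    (\<tau> \<bullet> \<kappa>) *\<^sub>R x - \<i> *\<^sub>C clifford_symmetry J R (cross3 \<tau> \<kappa>) x"
  unfolding clifford_symmetry_def
  by (simp add: fundamental_symmetry_linear[OF J] fundamental_symmetry_linear[OF R] RJ
      fundamental_symmetryD(3)[OF J] fundamental_symmetryD(3)[OF R]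
      cross_components inner_vec_def sum_3 algebra_simps scaleR_scaleC_commute)

text \<open>For equal indices the cross product in \<open>clifford_symmetry_product\<close>
  vanishes, so the square is the identity. Self-adjointness of the term \<i>JR rests on
  anti-commutation.\<close>

lemma fundamental_symmetry_clifford:
  assumes "\<alpha> \<in> sphere 0 1"
  shows "fundamental_symmetry (clifford_symmetry J R \<alpha>)"
  unfolding fundamental_symmetry_def
proof (intro conjI allI)
  note [simp] = fundamental_symmetry_linear[OF J] fundamental_symmetry_linear[OF R]
  have "bounded_linear (\<lambda>x. \<i> *\<^sub>C J (R x))"
    by (intro bounded_linear_compose[OF bounded_linear_scaleC]
        bounded_linear_compose[of J R]) simp_all
  then have "bounded_linear (clifford_symmetry J R \<alpha>)"
    unfolding clifford_symmetry_def
    by (intro bounded_linear_add bounded_linear_compose[OF bounded_linear_scaleR_right]) simp_all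
  then show "bounded_clinear (clifford_symmetry J R \<alpha>)"
    by (simp add: bounded_clinear_def clifford_symmetry_def
        scaleC_add_right scaleR_scaleC_commute mult.commute)
  fix x y
  show "cinner (clifford_symmetry J R \<alpha> x) y = cinner x (clifford_symmetry J R \<alpha> y)"
    by (simp add: clifford_symmetry_def cinner_simps RJ
        fundamental_symmetryD(2)[OF J] fundamental_symmetryD(2)[OF R] flip: scaleC_of_real)
  show "clifford_symmetry J R \<alpha> (clifford_symmetry J R \<alpha> x) = x"
    using assms clifford_symmetry_product[of \<alpha> \<alpha> x]
    by (simp add: dot_square_norm clifford_symmetry_def[of J R 0])
qed

text \<open>The cross product is skew, so the anti-commutator is the scalar 2(\<tau>, \<kappa>). The
  vector \<open>x\<close> excludes the zero space, where everything anti-commutes.\<close>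

lemma anticommuting_clifford_iff:
  assumes "x \<noteq> (0::'a)"
  shows "anticommuting (clifford_symmetry J R \<tau>) (clifford_symmetry J R \<kappa>) \<longleftrightarrow> \<tau> \<bullet> \<kappa> = 0"
proof -
  have "clifford_symmetry J R (cross3 \<kappa> \<tau>) y = - clifford_symmetry J R (cross3 \<tau> \<kappa>) y" for y
    by (subst cross_skew) (simp add: clifford_symmetry_def)
  then have "clifford_symmetry J R \<tau> (clifford_symmetry J R \<kappa> y)
      + clifford_symmetry J R \<kappa> (clifford_symmetry J R \<tau> y) = (2 * (\<tau> \<bullet> \<kappa>)) *\<^sub>R y" for y
    by (simp add: clifford_symmetry_product inner_commute[of \<kappa>] flip: scaleR_add_left)
  then show ?thesis
    unfolding anticommuting_def eq_neg_iff_add_eq_0 using assms by auto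
qed

text \<open>For orthogonal indices the Pauli relation makes \<i> times the product of the two
  symmetries the symmetry of the cross product, so rotated generators yield the same family.\<close>

lemma clifford_symmetry_change_frame:
  assumes "\<tau> \<bullet> \<kappa> = 0"
  shows "clifford_symmetry (clifford_symmetry J R \<tau>) (clifford_symmetry J R \<kappa>) \<beta> =
    clifford_symmetry J R (\<beta>$1 *\<^sub>R \<tau> + \<beta>$2 *\<^sub>R \<kappa> + \<beta>$3 *\<^sub>R cross3 \<tau> \<kappa>)"
proof
  fix x
  show "clifford_symmetry (clifford_symmetry J R \<tau>) (clifford_symmetry J R \<kappa>) \<beta> x =
    clifford_symmetry J R (\<beta>$1 *\<^sub>R \<tau> + \<beta>$2 *\<^sub>R \<kappa> + \<beta>$3 *\<^sub>R cross3 \<tau> \<kappa>) x"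
    unfolding clifford_symmetry_vec_linear
      clifford_symmetry_def[of "clifford_symmetry J R \<tau>" "clifford_symmetry J R \<kappa>"]
    by (simp add: clifford_symmetry_product assms)
qed

end

section \<open>Induced symmetries of the boundary space\<close>

lemma adjoint_op_iff:
  "(y, z) \<in> adjoint_op A \<longleftrightarrow> (\<forall>x w. (x, w) \<in> A \<longrightarrow> cinner w y = cinner x z)"
  by (auto simp: adjoint_op_def)

lemma adjoint_op_add:
  "(y, z) \<in> adjoint_op A \<Longrightarrow> (y', z') \<in> adjoint_op A \<Longrightarrow> (y + y', z + z') \<in> adjoint_op A"
  by (simp add: adjoint_op_iff cinner_add_right)

lemma adjoint_op_diff:
  "(y, z) \<in> adjoint_op A \<Longrightarrow> (y', z') \<in> adjoint_op A \<Longrightarrow> (y - y', z - z') \<in> adjoint_op A"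
  by (simp add: adjoint_op_iff cinner_diff_right)

lemma adjoint_op_scaleC: "(y, z) \<in> adjoint_op A \<Longrightarrow> (c *\<^sub>C y, c *\<^sub>C z) \<in> adjoint_op A"
  by (simp add: adjoint_op_iff cinner_scaleC_right)

lemma op_graph_iff [simp]: "(x, y) \<in> op_graph F \<longleftrightarrow> y = F x"
  by (auto simp: op_graph_def)

text \<open>Commutation says that \<open>K\<close> maps the graph of \<open>S\<close> into itself.
  Moving the self-adjoint \<open>K\<close> across the inner product transfers this to the
  adjoint.\<close>

lemma fundamental_symmetry_adjoint_domain:
  assumes K: "fundamental_symmetry K" and comm: "S \<odot> op_graph K = op_graph K \<odot> S"
    and f: "f \<in> Domain (adjoint_op S)"
  shows "K f \<in> Domain (adjoint_op S)"
proof -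
  have S: "(K x, K w) \<in> S" if "(x, w) \<in> S" for x w
  proof -
    have "(x, K w) \<in> op_graph K \<odot> S" using that by auto
    then have "(x, K w) \<in> S \<odot> op_graph K" unfolding comm .
    then show ?thesis by auto
  qed
  from f obtain z where z: "(f, z) \<in> adjoint_op S" by blast
  have "(K f, K z) \<in> adjoint_op S"
    using z S unfolding adjoint_op_iff by (metis fundamental_symmetryD(2)[OF K])
  then show ?thesis by blast
qed

lemma Domain_adjoint_op_closed:
  assumes "f \<in> Domain (adjoint_op S)"
  shows "g \<in> Domain (adjoint_op S) \<Longrightarrow> f + g \<in> Domain (adjoint_op S)"
    and "\<And>c. c *\<^sub>C f \<in> Domain (adjoint_op S)"
    and "r *\<^sub>R f \<in> Domain (adjoint_op S)"
proof -
  show "g \<in> Domain (adjoint_op S) \<Longrightarrow> f + g \<in> Domain (adjoint_op S)"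
    using assms adjoint_op_add by blast
  show *: "c *\<^sub>C f \<in> Domain (adjoint_op S)" for c
    using assms adjoint_op_scaleC by blast
  show "r *\<^sub>R f \<in> Domain (adjoint_op S)"
    using *[of "of_real r"] by (simp add: scaleC_of_real)
qed

lemma clifford_symmetry_adjoint_domain:
  assumes "\<And>f. f \<in> Domain (adjoint_op S) \<Longrightarrow> J f \<in> Domain (adjoint_op S)"
    and "\<And>f. f \<in> Domain (adjoint_op S) \<Longrightarrow> R f \<in> Domain (adjoint_op S)"
    and "f \<in> Domain (adjoint_op S)"
  shows "clifford_symmetry J R \<beta> f \<in> Domain (adjoint_op S)"
  unfolding clifford_symmetry_def by (intro Domain_adjoint_op_closed assms)

text \<open>The boundary maps are linear only on \<open>Domain (adjoint_op S)\<close>; the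
  invariance assumptions keep every term of the Clifford sum in that domain.\<close>

lemma intertwines_clifford:
  assumes bt: "boundary_triplet S \<Gamma>\<^sub>0 \<Gamma>\<^sub>1"
    and J: "\<And>f. f \<in> Domain (adjoint_op S) \<Longrightarrow> J f \<in> Domain (adjoint_op S)"
    and R: "\<And>f. f \<in> Domain (adjoint_op S) \<Longrightarrow> R f \<in> Domain (adjoint_op S)"
    and L: "intertwines S \<Gamma>\<^sub>0 \<Gamma>\<^sub>1 J L" and M: "intertwines S \<Gamma>\<^sub>0 \<Gamma>\<^sub>1 R M"
  shows "intertwines S \<Gamma>\<^sub>0 \<Gamma>\<^sub>1 (clifford_symmetry J R \<beta>) (clifford_symmetry L M \<beta>)"
proof -
  have "clifford_symmetry L M \<beta> (\<Gamma> f) = \<Gamma> (clifford_symmetry J R \<beta> f)"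
    if \<Gamma>: "\<Gamma> \<in> {\<Gamma>\<^sub>0, \<Gamma>\<^sub>1}" and f: "f \<in> Domain (adjoint_op S)" for \<Gamma> f
  proof -
    have add: "\<Gamma> (g + h) = \<Gamma> g + \<Gamma> h"
      if "g \<in> Domain (adjoint_op S)" "h \<in> Domain (adjoint_op S)" for g h
      using bt that \<Gamma> unfolding boundary_triplet_def by blast
    have scaleC: "\<Gamma> (c *\<^sub>C g) = c *\<^sub>C \<Gamma> g" if "g \<in> Domain (adjoint_op S)" for c g
      using bt that \<Gamma> unfolding boundary_triplet_def by blast
    have scaleR: "\<Gamma> (r *\<^sub>R g) = r *\<^sub>R \<Gamma> g" if "g \<in> Domain (adjoint_op S)" for r g
      using scaleC[OF that, of "of_real r"] by (simp add: scaleC_of_real)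
    have LM: "L (\<Gamma> g) = \<Gamma> (J g)" "M (\<Gamma> g) = \<Gamma> (R g)" if "g \<in> Domain (adjoint_op S)" for g
      using L M \<Gamma> that unfolding intertwines_def by auto
    show ?thesis
      unfolding clifford_symmetry_def
      by (simp add: add scaleC scaleR LM J R f Domain_adjoint_op_closed)
  qed
  then show ?thesis unfolding intertwines_def by blast
qed

lemma boundary_symmetry_eqI:
  assumes bt: "boundary_triplet S \<Gamma>\<^sub>0 \<Gamma>\<^sub>1" and L: "fundamental_symmetry L" "intertwines S \<Gamma>\<^sub>0 \<Gamma>\<^sub>1 K L"
  shows "boundary_symmetry S \<Gamma>\<^sub>0 \<Gamma>\<^sub>1 K = L"
  unfolding boundary_symmetry_def
proof (rule the_equality)
  fix M assume M: "fundamental_symmetry M \<and> intertwines S \<Gamma>\<^sub>0 \<Gamma>\<^sub>1 K M"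
  show "M = L"
  proof
    fix u
    obtain f where "f \<in> Domain (adjoint_op S)" "\<Gamma>\<^sub>0 f = u"
      using bt unfolding boundary_triplet_def by blast
    then show "M u = L u" using L M unfolding intertwines_def by metis
  qed
qed (use L in simp)

text \<open>Compatibility speaks of some pair \<tau>, \<kappa>, whereas the claim refers to
  \<open>J\<close> and \<open>R\<close>. Expanding in the frame of that pair gives a family
  \<open>L\<close> intertwined with all Clifford symmetries; its values at two coordinate axes are
  the symmetries induced by \<open>J\<close> and \<open>R\<close>.\<close>

lemma fundamental_symmetry_boundary_clifford:
  assumes J: "nontrivial_symmetry J" and R: "nontrivial_symmetry R" and anti: "anticommuting J R"
    and SJ: "S \<odot> op_graph J = op_graph J \<odot> S" and SR: "S \<odot> op_graph R = op_graph R \<odot> S"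
    and bt: "boundary_triplet S \<Gamma>\<^sub>0 \<Gamma>\<^sub>1" and compat: "compatible_triplet J R S \<Gamma>\<^sub>0 \<Gamma>\<^sub>1"
    and \<alpha>: "\<alpha> \<in> sphere 0 1"
  shows "fundamental_symmetry (clifford_symmetry
    (boundary_symmetry S \<Gamma>\<^sub>0 \<Gamma>\<^sub>1 J) (boundary_symmetry S \<Gamma>\<^sub>0 \<Gamma>\<^sub>1 R) \<alpha>)"
proof -
  let ?C = "clifford_symmetry J R"
  have JR: "fundamental_symmetry J" "fundamental_symmetry R"
    using J R by (auto simp: nontrivial_symmetry_def)
  \<comment> \<open>Non-triviality of \<open>J\<close> excludes the zero space, so that
    anti-commutation yields orthogonality of \<tau> and \<kappa>.\<close>
  obtain x where "J x \<noteq> x" using J by (auto simp: nontrivial_symmetry_def)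
  then have x: "x \<noteq> 0" using fundamental_symmetry_linear(5)[OF JR(1)] by auto
  interpret clifford_pair J R by unfold_locales (use JR anti in auto)
  obtain \<tau> \<kappa> L\<^sub>\<tau> L\<^sub>\<kappa> where \<tau>\<kappa>: "\<tau> \<in> sphere 0 1" "\<kappa> \<in> sphere 0 1"
      "anticommuting (?C \<tau>) (?C \<kappa>)"
    and L: "fundamental_symmetry L\<^sub>\<tau>" "fundamental_symmetry L\<^sub>\<kappa>" "anticommuting L\<^sub>\<tau> L\<^sub>\<kappa>"
      "intertwines S \<Gamma>\<^sub>0 \<Gamma>\<^sub>1 (?C \<tau>) L\<^sub>\<tau>" "intertwines S \<Gamma>\<^sub>0 \<Gamma>\<^sub>1 (?C \<kappa>) L\<^sub>\<kappa>"
    using compat unfolding compatible_triplet_def by blast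
  interpret L: clifford_pair L\<^sub>\<tau> L\<^sub>\<kappa> by unfold_locales (use L in auto)
  have orth: "\<tau> \<bullet> \<kappa> = 0" using anticommuting_clifford_iff[OF x] \<tau>\<kappa>(3) by blast
  \<comment> \<open>Coordinates in the orthonormal frame formed by \<tau>, \<kappa> and their cross
    product; this map preserves inner products.\<close>
  define \<beta> :: "real^3 \<Rightarrow> real^3"
    where "\<beta> = (\<lambda>\<sigma>. vector [\<tau> \<bullet> \<sigma>, \<kappa> \<bullet> \<sigma>, cross3 \<tau> \<kappa> \<bullet> \<sigma>])"
  define L where "L = (\<lambda>\<sigma>. clifford_symmetry L\<^sub>\<tau> L\<^sub>\<kappa> (\<beta> \<sigma>))"
  have frame: "clifford_symmetry (?C \<tau>) (?C \<kappa>) (\<beta> \<sigma>) = ?C \<sigma>" for \<sigma>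
    using orthonormal_frame_expansion[OF \<tau>\<kappa>(1,2) orth, of \<sigma>]
    by (simp add: clifford_symmetry_change_frame[OF orth] \<beta>_def vector_3)
  have \<beta>_inner: "\<beta> \<sigma> \<bullet> \<beta> \<sigma>' = \<sigma> \<bullet> \<sigma>'" for \<sigma> \<sigma>'
  proof -
    have "\<sigma> \<bullet> \<sigma>' = ((\<tau> \<bullet> \<sigma>) *\<^sub>R \<tau> + (\<kappa> \<bullet> \<sigma>) *\<^sub>R \<kappa> + (cross3 \<tau> \<kappa> \<bullet> \<sigma>) *\<^sub>R cross3 \<tau> \<kappa>) \<bullet> \<sigma>'"
      unfolding orthonormal_frame_expansion[OF \<tau>\<kappa>(1,2) orth] ..
    then show ?thesis
      by (simp add: \<beta>_def inner_vec_def[of "vector _"] sum_3 vector_3 inner_add_left)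
  qed
  have fs: "fundamental_symmetry (L \<sigma>)" if "\<sigma> \<in> sphere 0 1" for \<sigma>
    unfolding L_def
    by (rule L.fundamental_symmetry_clifford)
      (use that \<beta>_inner[of \<sigma> \<sigma>] in \<open>simp add: norm_eq_sqrt_inner\<close>)
  have D: "?C \<sigma> f \<in> Domain (adjoint_op S)" if "f \<in> Domain (adjoint_op S)" for \<sigma> f
    by (rule clifford_symmetry_adjoint_domain[OF fundamental_symmetry_adjoint_domain[OF JR(1) SJ]
          fundamental_symmetry_adjoint_domain[OF JR(2) SR] that])
  have "intertwines S \<Gamma>\<^sub>0 \<Gamma>\<^sub>1 (clifford_symmetry (?C \<tau>) (?C \<kappa>) (\<beta> \<sigma>)) (L \<sigma>)" for \<sigma>
    unfolding L_def by (intro intertwines_clifford bt D L)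
  then have tw: "intertwines S \<Gamma>\<^sub>0 \<Gamma>\<^sub>1 (?C \<sigma>) (L \<sigma>)" for \<sigma>
    unfolding frame .
  have bs: "boundary_symmetry S \<Gamma>\<^sub>0 \<Gamma>\<^sub>1 J = L (axis 1 1)" "boundary_symmetry S \<Gamma>\<^sub>0 \<Gamma>\<^sub>1 R = L (axis 2 1)"
    by (intro boundary_symmetry_eqI bt fs; use tw[of "axis 1 1"] tw[of "axis 2 1"] in
        \<open>simp add: clifford_symmetry_axis\<close>)+
  \<comment> \<open>The boundary space may be zero; it then has no witness for
    \<open>anticommuting_clifford_iff\<close>, but the claim is trivial.\<close>
  have *: "anticommuting (L (axis 1 1)) (L (axis 2 1))"
  proof (cases "\<exists>x::'b. x \<noteq> 0")
    case True
    then show ?thesis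
      by (auto simp: L_def L.anticommuting_clifford_iff \<beta>_inner inner_axis_axis)
  next
    case False
    then show ?thesis unfolding anticommuting_def by metis
  qed
  interpret B: clifford_pair "boundary_symmetry S \<Gamma>\<^sub>0 \<Gamma>\<^sub>1 J" "boundary_symmetry S \<Gamma>\<^sub>0 \<Gamma>\<^sub>1 R"
    unfolding bs by unfold_locales (use fs * in auto)
  show ?thesis by (rule B.fundamental_symmetry_clifford[OF \<alpha>])
qed

section \<open>Cayley transforms and resolvents\<close>

lemma densely_definedI:
  fixes A :: "('a::complex_hilbert_space \<times> 'b) set"
  assumes "csubspace (Domain A)"
    and "\<And>q. (\<And>v. v \<in> Domain A \<Longrightarrow> cinner q v = 0) \<Longrightarrow> q = 0"
  shows "densely_defined A"
proof -
  have "x \<in> closure (Domain A)" for x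
  proof (rule in_closure_if_orthogonal[OF assms(1)])
    fix q assume "\<And>v. v \<in> Domain A \<Longrightarrow> cinner q v = 0"
    then have "q = 0" by (rule assms(2))
    then show "cinner q x = 0" by simp
  qed
  then show ?thesis by (auto simp: densely_defined_def)
qed

lemma unitaryD:
  assumes "unitary U"
  shows "bounded_clinear U" "cinner (U x) (U y) = cinner x y" "surj U"
  using assms by (auto simp: unitary_def)

lemma unitary_left_eqI:
  assumes "unitary U" "\<And>x. cinner (U x) y = cinner (U x) z"
  shows "y = z"
  by (rule cinner_left_eqI) (metis assms unitaryD(3) surjD)

text \<open>For u = x - U x and K v = \<i>(x + U x), the vectors K v + \<i>u and K v - \<i>u are
  2\<i>x and 2\<i>U x. The equivalence is one of relations, so single-valuedness can be treated
  separately.\<close>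

lemma krein_cayley_iff:
  fixes U K :: "'h::complex_inner \<Rightarrow> 'h"
  assumes U: "unitary U" and K: "fundamental_symmetry K"
  shows "(u, v) \<in> op_graph (\<lambda>x. \<i> *\<^sub>C K (x + U x)) \<odot> (op_graph (\<lambda>x. x - U x))\<inverse> \<longleftrightarrow>
    U (K v + \<i> *\<^sub>C u) = K v - \<i> *\<^sub>C u" (is "?l \<longleftrightarrow> ?r")
proof
  note [simp] = fundamental_symmetry_linear[OF K] fundamental_symmetryD(3)[OF K]
    bounded_clinearD[OF unitaryD(1)[OF U]]
  have double: "(2 * c) *\<^sub>C x = c *\<^sub>C x + c *\<^sub>C x" for c and x :: 'h
    by (simp only: mult_2 scaleC_add_left)
  {
    assume ?l
    then obtain x where x: "u = x - U x" "v = \<i> *\<^sub>C K (x + U x)" by auto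
    have "K v + \<i> *\<^sub>C u = (2 * \<i>) *\<^sub>C x" "K v - \<i> *\<^sub>C u = (2 * \<i>) *\<^sub>C U x"
      unfolding double x by (simp_all add: algebra_simps)
    then show ?r by simp
  next
    assume r: ?r
    \<comment> \<open>Solves K v + \<i>u = 2\<i>x for the parameter.\<close>
    define x where "x = (- \<i> / 2) *\<^sub>C (K v + \<i> *\<^sub>C u)"
    have x: "x = (- \<i> / 2) *\<^sub>C K v + (1 / 2) *\<^sub>C u"
      by (simp add: x_def scaleC_add_right)
    have "U x = (- \<i> / 2) *\<^sub>C (K v - \<i> *\<^sub>C u)"
      unfolding x_def r[symmetric] by (rule bounded_clinearD(6)[OF unitaryD(1)[OF U]])
    then have Ux: "U x = (- \<i> / 2) *\<^sub>C K v - (1 / 2) *\<^sub>C u"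
      by (simp add: scaleC.scale_right_diff_distrib)
    have "u = x - U x" unfolding Ux unfolding x using double[of "1/2" u] by simp
    moreover have "x + U x = (- \<i>) *\<^sub>C K v" unfolding Ux unfolding x using double[of "- \<i> / 2" "K v"] by simp
    then have "v = \<i> *\<^sub>C K (x + U x)" by simp
    ultimately show ?l by auto
  }
qed

text \<open>Absence of fixed vectors gives both single-valuedness and density of the domain. The
  adjoint is computed by testing against the parametrization by \<open>x\<close>.\<close>

lemma krein_self_adjoint_cayley:
  fixes U K :: "'h::complex_hilbert_space \<Rightarrow> 'h"
  assumes U: "unitary U" and K: "fundamental_symmetry K" and fix0: "\<And>x. U x = x \<Longrightarrow> x = 0"
  shows "krein_self_adjoint K (op_graph (\<lambda>x. \<i> *\<^sub>C K (x + U x)) \<odot> (op_graph (\<lambda>x. x - U x))\<inverse>)"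
    (is "krein_self_adjoint K ?T")
proof -
  note iff = krein_cayley_iff[OF U K]
  have param: "(u, v) \<in> ?T \<longleftrightarrow> (\<exists>x. u = x - U x \<and> v = \<i> *\<^sub>C K (x + U x))" for u v
    unfolding relcomp_unfold by simp
  note Klin = fundamental_symmetry_linear[OF K] and KK = fundamental_symmetryD(3)[OF K]
  note Ulin = bounded_clinearD[OF unitaryD(1)[OF U]]
  have lin: "linear_operator ?T"
    unfolding linear_operator_def
  proof (intro conjI allI impI single_valuedI)
    fix u v v' assume "(u, v) \<in> ?T" "(u, v') \<in> ?T"
    \<comment> \<open>Subtracting the two defining equations makes \<open>K v - K v'\<close> a fixed
      vector of \<open>U\<close>.\<close>
    then have "U (K v + \<i> *\<^sub>C u) - U (K v' + \<i> *\<^sub>C u) = K v - K v'"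
      unfolding iff by simp
    then have "K v - K v' = 0" by (intro fix0) (simp add: Ulin)
    then show "v = v'" using KK by (metis eq_iff_diff_eq_0)
  next
    fix x y x' y' assume "(x, y) \<in> ?T" "(x', y') \<in> ?T"
    then have "U ((K y + \<i> *\<^sub>C x) + (K y' + \<i> *\<^sub>C x')) = (K y - \<i> *\<^sub>C x) + (K y' - \<i> *\<^sub>C x')"
      unfolding iff by (simp only: Ulin)
    then show "(x + x', y + y') \<in> ?T"
      unfolding iff unfolding Klin scaleC_add_right by (simp only: add_diff_add add.assoc add.left_commute)
  next
    fix c x y assume "(x, y) \<in> ?T"
    then have "U (c *\<^sub>C (K y + \<i> *\<^sub>C x)) = c *\<^sub>C (K y - \<i> *\<^sub>C x)"
      unfolding iff by (simp only: Ulin)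
    then show "(c *\<^sub>C x, c *\<^sub>C y) \<in> ?T"
      unfolding iff unfolding Klin scaleC_add_right scaleC.scale_right_diff_distrib by (simp add: mult.commute)
  next
    show "(0, 0) \<in> ?T" unfolding iff by (simp add: Klin Ulin)
  qed
  have dense: "densely_defined ?T"
  proof (rule densely_definedI)
    show "csubspace (Domain ?T)"
      using lin unfolding linear_operator_def csubspace_def by blast
    fix q assume q: "\<And>v. v \<in> Domain ?T \<Longrightarrow> cinner q v = 0"
    \<comment> \<open>As \<open>q\<close> is orthogonal to the range of I - U, (U x, U q) = (x, q) =
      (U x, q); hence \<open>U\<close> fixes \<open>q\<close>.\<close>
    have "cinner (U x) (U q) = cinner (U x) q" for x
    proof -
      have "cinner q (x - U x) = 0" by (rule q) (use param in blast)
      then show ?thesis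
        unfolding unitaryD(2)[OF U] by (metis cinner_diff_right cinner_commute eq_iff_diff_eq_0)
    qed
    then have "U q = q" by (rule unitary_left_eqI[OF U])
    then show "q = 0" by (rule fix0)
  qed
  have "(K y, z) \<in> adjoint_op ?T \<longleftrightarrow> (y, K z) \<in> ?T" for y z
  proof -
    \<comment> \<open>Since \<open>U\<close> is surjective, vanishing for all \<open>x\<close> means
      U(z + \<i>y) = z - \<i>y, the defining equation of the relation at
      \<open>(y, K z)\<close>.\<close>
    have *: "cinner (\<i> *\<^sub>C K (x + U x)) (K y) - cinner (x - U x) z =
        cinner (U x) (z - \<i> *\<^sub>C y) - cinner (U x) (U (z + \<i> *\<^sub>C y))" for x
      unfolding unitaryD(2)[OF U]
      by (simp add: cinner_simps fundamental_symmetryD(2)[OF K] KK algebra_simps)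
    have "(K y, z) \<in> adjoint_op ?T \<longleftrightarrow>
        (\<forall>x. cinner (\<i> *\<^sub>C K (x + U x)) (K y) - cinner (x - U x) z = 0)"
      unfolding adjoint_op_iff param by auto
    also have "\<dots> \<longleftrightarrow> U (z + \<i> *\<^sub>C y) = z - \<i> *\<^sub>C y"
      unfolding * by (auto intro!: unitary_left_eqI[OF U])
    also have "\<dots> \<longleftrightarrow> (y, K z) \<in> ?T" by (simp add: iff KK)
    finally show ?thesis .
  qed
  moreover have "(y, K z) \<in> ?T \<longleftrightarrow> (y, z) \<in> op_graph K \<odot> ?T" for y z
    unfolding relcomp_unfold[of ?T] mem_Collect_eq case_prod_conv op_graph_iff using KK by metis
  ultimately have "adjoint_op ?T \<odot> op_graph K = op_graph K \<odot> ?T"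
    by (auto simp: relcomp_unfold[of "op_graph K"])
  with K lin dense show ?thesis by (simp add: krein_self_adjoint_def)
qed

section \<open>Resolvents and ranges of shifted operators\<close>

lemma resolvent_iff: "(y, x) \<in> resolvent A \<mu> \<longleftrightarrow> (x, y + \<mu> *\<^sub>C x) \<in> A"
proof
  assume "(y, x) \<in> resolvent A \<mu>"
  then show "(x, y + \<mu> *\<^sub>C x) \<in> A"
    by (auto simp: resolvent_def op_minus_def)
next
  assume "(x, y + \<mu> *\<^sub>C x) \<in> A"
  then have "\<exists>w. (x, w) \<in> A \<and> y = w - \<mu> *\<^sub>C x" by (intro exI[of _ "y + \<mu> *\<^sub>C x"]) simp
  then show "(y, x) \<in> resolvent A \<mu>"
    by (auto simp: resolvent_def op_minus_def)
qed

lemma resolvent_setE: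
  assumes "\<mu> \<in> resolvent_set A"
  obtains F where "bounded_clinear F" "resolvent A \<mu> = op_graph F"
    "\<And>x y. (x, y + \<mu> *\<^sub>C x) \<in> A \<longleftrightarrow> x = F y"
proof -
  from assms obtain F where F: "bounded_clinear F" "resolvent A \<mu> = op_graph F"
    unfolding resolvent_set_def by blast
  have "(x, y + \<mu> *\<^sub>C x) \<in> A \<longleftrightarrow> x = F y" for x y
    using resolvent_iff[of y x A \<mu>] unfolding F(2) by simp
  with F that show ?thesis by blast
qed

lemma eigenvector_zero:
  assumes "\<mu> \<in> resolvent_set A" "(f, \<mu> *\<^sub>C f) \<in> A"
  shows "f = 0"
proof -
  obtain F where F: "bounded_clinear F" "\<And>x y. (x, y + \<mu> *\<^sub>C x) \<in> A \<longleftrightarrow> x = F y"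
    using assms(1) by (rule resolvent_setE) blast
  show ?thesis using F(2)[of f 0] assms(2) bounded_clinearD(5)[OF F(1)] by simp
qed

text \<open>The bounded resolvent of the extension \<open>A\<close> recovers each preimage, so
  convergence in the range forces convergence of the graph points, whose limit stays in the closed
  \<open>S\<close>.\<close>

lemma closed_range_minus:
  assumes S: "closed S" "S \<subseteq> A" and \<mu>: "\<mu> \<in> resolvent_set A"
  shows "closed {w - \<mu> *\<^sub>C x | x w. (x, w) \<in> S}"
  unfolding closed_sequential_limits
proof (intro allI impI, elim conjE)
  fix y l assume y: "\<forall>n. y n \<in> {w - \<mu> *\<^sub>C x | x w. (x, w) \<in> S}" and l: "y \<longlonglongrightarrow> l"
  obtain F where F: "bounded_clinear F" "\<And>x y. (x, y + \<mu> *\<^sub>C x) \<in> A \<longleftrightarrow> x = F y"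
    using \<mu> by (rule resolvent_setE) blast
  have in_S: "(F (y n), y n + \<mu> *\<^sub>C F (y n)) \<in> S" for n
  proof -
    obtain x w where xw: "y n = w - \<mu> *\<^sub>C x" "(x, w) \<in> S" using y by blast
    then have "(x, y n + \<mu> *\<^sub>C x) \<in> S" by simp
    moreover from this have "x = F (y n)" using F(2) S(2) by blast
    ultimately show ?thesis by simp
  qed
  have Fl: "(\<lambda>n. F (y n)) \<longlonglongrightarrow> F l"
    by (rule bounded_linear.tendsto[OF bounded_clinearD(1)[OF F(1)] l])
  have lim: "(\<lambda>n. (F (y n), y n + \<mu> *\<^sub>C F (y n))) \<longlonglongrightarrow> (F l, l + \<mu> *\<^sub>C F l)"
    by (intro tendsto_Pair tendsto_add l Fl bounded_linear.tendsto[OF bounded_linear_scaleC])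
  have "(F l, l + \<mu> *\<^sub>C F l) \<in> S"
    by (rule closed_sequentially[OF S(1) _ lim]) (use in_S in blast)
  then show "l \<in> {w - \<mu> *\<^sub>C x | x w. (x, w) \<in> S}"
    by (intro CollectI exI[of _ "F l"] exI[of _ "l + \<mu> *\<^sub>C F l"]) simp
qed

text \<open>One inclusion of the identity between the orthogonal complement of the range of
  \<open>S - \<mu>\<close> and the kernel of the adjoint at \<open>cnj \<mu>\<close>.\<close>

lemma orthogonal_range_minus:
  assumes "\<And>x w. (x, w) \<in> S \<Longrightarrow> cinner q (w - \<mu> *\<^sub>C x) = 0"
  shows "(q, cnj \<mu> *\<^sub>C q) \<in> adjoint_op S"
  unfolding adjoint_op_iff
proof (intro allI impI)
  fix x w assume "(x, w) \<in> S"
  then have "cinner (w - \<mu> *\<^sub>C x) q = 0" using assms by (metis cinner_commute complex_cnj_zero)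
  then show "cinner w q = cinner x (cnj \<mu> *\<^sub>C q)" by (simp add: cinner_simps)
qed

section \<open>The resolvent formula\<close>

text \<open>The resolvent formula is proved here for a general parameter \<open>T\<close>; the
  Clifford symmetries enter when \<open>T\<close> is specialised in the final theorem.\<close>

locale boundary_triplet_space =
  fixes S :: "('a::complex_hilbert_space \<times> 'a) set"
    and \<Gamma>\<^sub>0 \<Gamma>\<^sub>1 :: "'a \<Rightarrow> 'h::complex_hilbert_space"
  assumes linear_S: "linear_operator S" and closed_S: "closed S" and symmetric_S: "symmetric_op S"
    and bt: "boundary_triplet S \<Gamma>\<^sub>0 \<Gamma>\<^sub>1"
begin

definition A\<^sub>0 :: "('a \<times> 'a) set"
  where "A\<^sub>0 = {(f, g) \<in> adjoint_op S. \<Gamma>\<^sub>0 f = 0}"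

lemma \<Gamma>_add:
  assumes "(f, f') \<in> adjoint_op S" "(g, g') \<in> adjoint_op S"
  shows "\<Gamma>\<^sub>0 (f + g) = \<Gamma>\<^sub>0 f + \<Gamma>\<^sub>0 g" "\<Gamma>\<^sub>1 (f + g) = \<Gamma>\<^sub>1 f + \<Gamma>\<^sub>1 g"
  using bt DomainI[OF assms(1)] DomainI[OF assms(2)] by (auto simp: boundary_triplet_def)

lemma \<Gamma>_scaleC:
  assumes "(f, f') \<in> adjoint_op S"
  shows "\<Gamma>\<^sub>0 (c *\<^sub>C f) = c *\<^sub>C \<Gamma>\<^sub>0 f" "\<Gamma>\<^sub>1 (c *\<^sub>C f) = c *\<^sub>C \<Gamma>\<^sub>1 f"
  using bt DomainI[OF assms(1)] by (auto simp: boundary_triplet_def)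

lemma \<Gamma>_diff:
  assumes "(f, f') \<in> adjoint_op S" "(g, g') \<in> adjoint_op S"
  shows "\<Gamma>\<^sub>0 (f - g) = \<Gamma>\<^sub>0 f - \<Gamma>\<^sub>0 g" "\<Gamma>\<^sub>1 (f - g) = \<Gamma>\<^sub>1 f - \<Gamma>\<^sub>1 g"
  using \<Gamma>_add[OF assms(1) adjoint_op_scaleC[OF assms(2), of "-1"]] \<Gamma>_scaleC[OF assms(2), of "-1"]
  by simp_all

lemma green:
  assumes "(x, x') \<in> adjoint_op S" "(y, y') \<in> adjoint_op S"
  shows "cinner x' y - cinner x y' = cinner (\<Gamma>\<^sub>1 x) (\<Gamma>\<^sub>0 y) - cinner (\<Gamma>\<^sub>0 x) (\<Gamma>\<^sub>1 y)"
  using bt assms unfolding boundary_triplet_def by blast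

lemma \<Gamma>_surj:
  obtains f f' where "(f, f') \<in> adjoint_op S" "\<Gamma>\<^sub>0 f = u" "\<Gamma>\<^sub>1 f = v"
  using bt unfolding boundary_triplet_def by blast

lemma S_subset: "S \<subseteq> adjoint_op S"
  using symmetric_S by (simp add: symmetric_op_def)

text \<open>The left side of Green's identity vanishes between \<open>S\<close> and its adjoint. The
  boundary values of the second vector are arbitrary, so they can be chosen to test each boundary
  value of \<open>x\<close> against itself.\<close>

lemma \<Gamma>_eq_0_on_S:
  assumes "(x, w) \<in> S"
  shows "\<Gamma>\<^sub>0 x = 0" "\<Gamma>\<^sub>1 x = 0"
proof -
  have *: "cinner (\<Gamma>\<^sub>1 x) u = cinner (\<Gamma>\<^sub>0 x) v" for u v
  proof -
    obtain f f' where f: "(f, f') \<in> adjoint_op S" "\<Gamma>\<^sub>0 f = u" "\<Gamma>\<^sub>1 f = v" by (rule \<Gamma>_surj)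
    have "cinner w f = cinner x f'" using f(1) assms by (simp add: adjoint_op_iff)
    then show ?thesis using green[OF subsetD[OF S_subset assms] f(1)] f by simp
  qed
  show "\<Gamma>\<^sub>0 x = 0" using *[of 0 "\<Gamma>\<^sub>0 x"] by (simp add: cinner_self_eq_0_iff)
  show "\<Gamma>\<^sub>1 x = 0" using *[of "\<Gamma>\<^sub>1 x" 0] by (simp add: cinner_self_eq_0_iff)
qed

lemma S_subset_A\<^sub>0: "S \<subseteq> A\<^sub>0"
  using S_subset \<Gamma>_eq_0_on_S by (auto simp: A\<^sub>0_def)

lemma \<Gamma>\<^sub>0_eigenspace_dense:
  assumes \<mu>: "\<mu> \<in> resolvent_set A\<^sub>0"
    and z: "\<And>f. (f, cnj \<mu> *\<^sub>C f) \<in> adjoint_op S \<Longrightarrow> cinner (\<Gamma>\<^sub>0 f) z = 0"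
  shows "z = 0"
proof -
  obtain h h' where h: "(h, h') \<in> adjoint_op S" "\<Gamma>\<^sub>0 h = 0" "\<Gamma>\<^sub>1 h = z" by (rule \<Gamma>_surj)
  define V where "V = {w - \<mu> *\<^sub>C x | x w. (x, w) \<in> S}"
  have "csubspace V"
    unfolding csubspace_def
  proof (intro conjI ballI allI)
    have "(0, 0) \<in> S" using linear_S by (simp add: linear_operator_def)
    then show "0 \<in> V" unfolding V_def by (intro CollectI exI[of _ 0]) simp
  next
    fix p q assume "p \<in> V" "q \<in> V"
    then obtain x w x' w' where *: "p = w - \<mu> *\<^sub>C x" "(x, w) \<in> S" "q = w' - \<mu> *\<^sub>C x'" "(x', w') \<in> S"
      by (auto simp: V_def)
    have "(x + x', w + w') \<in> S" using linear_S *(2,4) by (auto simp: linear_operator_def)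
    moreover have "p + q = (w + w') - \<mu> *\<^sub>C (x + x')" by (simp add: *(1,3) algebra_simps)
    ultimately show "p + q \<in> V" unfolding V_def by blast
  next
    fix c p assume "p \<in> V"
    then obtain x w where *: "p = w - \<mu> *\<^sub>C x" "(x, w) \<in> S" by (auto simp: V_def)
    have "(c *\<^sub>C x, c *\<^sub>C w) \<in> S" using linear_S *(2) by (auto simp: linear_operator_def)
    moreover have "c *\<^sub>C p = c *\<^sub>C w - \<mu> *\<^sub>C (c *\<^sub>C x)" by (simp add: *(1) algebra_simps)
    ultimately show "c *\<^sub>C p \<in> V" unfolding V_def by blast
  qed
  moreover have "cinner q (h' - \<mu> *\<^sub>C h) = 0" if q: "\<And>v. v \<in> V \<Longrightarrow> cinner q v = 0" for q
  proof -
    \<comment> \<open>Green's identity for \<open>q\<close> and \<open>h\<close> equates (q, h' -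
      \<mu>h) with the inner product of \<open>\<Gamma>\<^sub>0 q\<close> and \<open>z\<close>,
      which vanishes by hypothesis.\<close>
    have "(q, cnj \<mu> *\<^sub>C q) \<in> adjoint_op S"
      by (rule orthogonal_range_minus) (use q in \<open>auto simp: V_def\<close>)
    from green[OF this h(1)] z[OF this] show ?thesis by (simp add: h cinner_simps)
  qed
  ultimately have "h' - \<mu> *\<^sub>C h \<in> closure V" by (rule in_closure_if_orthogonal)
  then have "h' - \<mu> *\<^sub>C h \<in> V"
    using closed_range_minus[OF closed_S S_subset_A\<^sub>0 \<mu>] by (simp add: V_def)
  then obtain x w where xw: "(x, w) \<in> S" "h' - \<mu> *\<^sub>C h = w - \<mu> *\<^sub>C x" by (auto simp: V_def)
  note xw' = subsetD[OF S_subset xw(1)]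
  have "(h - x, \<mu> *\<^sub>C (h - x)) \<in> A\<^sub>0"
  proof -
    have "h' - w = \<mu> *\<^sub>C (h - x)" using xw(2) by (simp add: algebra_simps)
    then show ?thesis
      using adjoint_op_diff[OF h(1) xw'] \<Gamma>_diff(1)[OF h(1) xw'] h(2) \<Gamma>_eq_0_on_S(1)[OF xw(1)]
      by (simp add: A\<^sub>0_def)
  qed
  from eigenvector_zero[OF \<mu> this] have "h = x" by simp
  then show ?thesis using h(3) \<Gamma>_eq_0_on_S(2)[OF xw(1)] by simp
qed

section \<open>The \<gamma>-field, the Weyl function and the resolvent difference\<close>

lemma gamma_field_iff:
  "(u, f) \<in> gamma_field S \<Gamma>\<^sub>0 \<mu> \<longleftrightarrow> (f, \<mu> *\<^sub>C f) \<in> adjoint_op S \<and> u = \<Gamma>\<^sub>0 f"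
  by (auto simp: gamma_field_def eigenspace_def)

lemma weyl_function_iff:
  "(u, v) \<in> weyl_function S \<Gamma>\<^sub>0 \<Gamma>\<^sub>1 \<mu> \<longleftrightarrow>
    (\<exists>f. (f, \<mu> *\<^sub>C f) \<in> adjoint_op S \<and> u = \<Gamma>\<^sub>0 f \<and> v = \<Gamma>\<^sub>1 f)"
  by (auto simp: weyl_function_def eigenspace_def)

text \<open>\<open>F\<close> is the resolvent of \<open>A\<^sub>0\<close>, so
  \<open>\<Gamma>\<^sub>0 (F y) = 0\<close> and one boundary term of Green's identity drops out.
  Equality with a full graph also records that the adjoint is everywhere defined.\<close>

lemma adjoint_gamma_field:
  assumes \<mu>: "\<mu> \<in> resolvent_set A\<^sub>0"
    and F: "\<And>x y. (x, y + \<mu> *\<^sub>C x) \<in> A\<^sub>0 \<longleftrightarrow> x = F y"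
  shows "adjoint_op (gamma_field S \<Gamma>\<^sub>0 (cnj \<mu>)) = op_graph (\<lambda>y. \<Gamma>\<^sub>1 (F y))"
proof -
  have *: "cinner f y = cinner (\<Gamma>\<^sub>0 f) (\<Gamma>\<^sub>1 (F y))" if f: "(f, cnj \<mu> *\<^sub>C f) \<in> adjoint_op S" for f y
  proof -
    have h: "(F y, y + \<mu> *\<^sub>C F y) \<in> adjoint_op S" "\<Gamma>\<^sub>0 (F y) = 0"
      using F[of "F y" y] by (auto simp: A\<^sub>0_def)
    show ?thesis using green[OF f h(1)] by (simp add: h(2) cinner_simps)
  qed
  have "(y, z) \<in> adjoint_op (gamma_field S \<Gamma>\<^sub>0 (cnj \<mu>)) \<longleftrightarrow> z = \<Gamma>\<^sub>1 (F y)" for y z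
  proof -
    have "(y, z) \<in> adjoint_op (gamma_field S \<Gamma>\<^sub>0 (cnj \<mu>)) \<longleftrightarrow>
        (\<forall>f. (f, cnj \<mu> *\<^sub>C f) \<in> adjoint_op S \<longrightarrow> cinner f y = cinner (\<Gamma>\<^sub>0 f) z)"
      unfolding adjoint_op_iff[of _ _ "gamma_field S \<Gamma>\<^sub>0 (cnj \<mu>)"] gamma_field_iff by blast
    also have "\<dots> \<longleftrightarrow>
        (\<forall>f. (f, cnj \<mu> *\<^sub>C f) \<in> adjoint_op S \<longrightarrow> cinner (\<Gamma>\<^sub>0 f) (z - \<Gamma>\<^sub>1 (F y)) = 0)"
      unfolding cinner_diff_right using *[of _ y] by (metis eq_iff_diff_eq_0)
    also have "\<dots> \<longleftrightarrow> z - \<Gamma>\<^sub>1 (F y) = 0"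
      using \<Gamma>\<^sub>0_eigenspace_dense[OF \<mu>] cinner_zero_right by metis
    finally show ?thesis by simp
  qed
  then show ?thesis by (auto simp: set_eq_iff)
qed

text \<open>Membership of \<mu> in the resolvent set of \<open>A\<close> makes \<open>N\<close>
  single-valued; membership in that of \<open>A\<^sub>0\<close> does the same for the
  \<gamma>-field.\<close>

lemma krein_resolvent_formula:
  assumes T: "linear_operator T"
    and A: "\<And>f g. (f, g) \<in> A \<longleftrightarrow> (f, g) \<in> adjoint_op S \<and> (\<Gamma>\<^sub>0 f, \<Gamma>\<^sub>1 f) \<in> T"
    and \<mu>: "\<mu> \<in> resolvent_set A" "\<mu> \<in> resolvent_set A\<^sub>0"
  defines "N \<equiv> (weyl_function S \<Gamma>\<^sub>0 \<Gamma>\<^sub>1 \<mu> \<ominus> T)\<inverse>"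
  shows "linear_operator N"
    and "resolvent A \<mu> = resolvent A\<^sub>0 \<mu> \<ominus>
      gamma_field S \<Gamma>\<^sub>0 \<mu> \<odot> N \<odot> adjoint_op (gamma_field S \<Gamma>\<^sub>0 (cnj \<mu>))"
proof -
  have T_sv: "v = v'" if "(u, v) \<in> T" "(u, v') \<in> T" for u v v'
    using T that by (auto simp: linear_operator_def single_valued_def)
  have T_add: "(u + u', v + v') \<in> T" if "(u, v) \<in> T" "(u', v') \<in> T" for u u' v v'
    using T that by (auto simp: linear_operator_def)
  have T_scale: "(c *\<^sub>C u, c *\<^sub>C v) \<in> T" if "(u, v) \<in> T" for c u v
    using T that by (auto simp: linear_operator_def)
  have T_diff: "(u - u', v - v') \<in> T" if "(u, v) \<in> T" "(u', v') \<in> T" for u u' v v'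
    using T_add[OF that(1) T_scale[OF that(2), of "-1"]] by simp
  have N_iff: "(z, u) \<in> N \<longleftrightarrow>
      (\<exists>f v. (f, \<mu> *\<^sub>C f) \<in> adjoint_op S \<and> u = \<Gamma>\<^sub>0 f \<and> (u, v) \<in> T \<and> z = \<Gamma>\<^sub>1 f - v)" for z u
    by (auto simp: N_def op_minus_def weyl_function_iff)
  have eig_0: "f = 0" if "(f, \<mu> *\<^sub>C f) \<in> adjoint_op S" "(\<Gamma>\<^sub>0 f, \<Gamma>\<^sub>1 f) \<in> T" for f
    using eigenvector_zero[OF \<mu>(1)] A that by blast
  have N_sv: "u = u'" if N: "(z, u) \<in> N" "(z, u') \<in> N" for z u u'
  proof -
    obtain f v f' v' where f: "(f, \<mu> *\<^sub>C f) \<in> adjoint_op S" "u = \<Gamma>\<^sub>0 f" "(u, v) \<in> T" "z = \<Gamma>\<^sub>1 f - v"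
      and f': "(f', \<mu> *\<^sub>C f') \<in> adjoint_op S" "u' = \<Gamma>\<^sub>0 f'" "(u', v') \<in> T" "z = \<Gamma>\<^sub>1 f' - v'"
      using N unfolding N_iff by blast
    have "\<Gamma>\<^sub>1 f - \<Gamma>\<^sub>1 f' = v - v'" using f(4) f'(4) by (simp add: algebra_simps)
    \<comment> \<open>The difference satisfies the boundary condition of \<open>A\<close>, so it is
      an eigenvector of \<open>A\<close> at \<mu> and vanishes.\<close>
    then have "(\<Gamma>\<^sub>0 (f - f'), \<Gamma>\<^sub>1 (f - f')) \<in> T"
      using T_diff[OF f(3) f'(3)] f(2) f'(2) by (simp add: \<Gamma>_diff[OF f(1) f'(1)])
    moreover have "(f - f', \<mu> *\<^sub>C (f - f')) \<in> adjoint_op S"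
      using adjoint_op_diff[OF f(1) f'(1)] by (simp add: algebra_simps)
    ultimately have "f - f' = 0" by (intro eig_0)
    then show ?thesis using f(2) f'(2) by simp
  qed
  have \<gamma>_sv: "f = f'" if "(u, f) \<in> gamma_field S \<Gamma>\<^sub>0 \<mu>" "(u, f') \<in> gamma_field S \<Gamma>\<^sub>0 \<mu>" for u f f'
  proof -
    have f: "(f, \<mu> *\<^sub>C f) \<in> adjoint_op S" "(f', \<mu> *\<^sub>C f') \<in> adjoint_op S" "\<Gamma>\<^sub>0 f = \<Gamma>\<^sub>0 f'"
      using that by (auto simp: gamma_field_iff)
    have "(f - f', \<mu> *\<^sub>C (f - f')) \<in> A\<^sub>0"
      using adjoint_op_diff[OF f(1,2)] \<Gamma>_diff(1)[OF f(1,2)] f(3)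
      by (simp add: A\<^sub>0_def scaleC.scale_right_diff_distrib)
    from eigenvector_zero[OF \<mu>(2) this] show ?thesis by simp
  qed
  show "linear_operator N"
    unfolding linear_operator_def
  proof (intro conjI allI impI single_valuedI)
    show "(0, 0) \<in> N"
    proof -
      have "(0, 0) \<in> T" using T by (simp add: linear_operator_def)
      moreover have "(0, 0) \<in> adjoint_op S" by (simp add: adjoint_op_iff)
      moreover from \<Gamma>_diff[OF this this] have "\<Gamma>\<^sub>0 0 = 0" "\<Gamma>\<^sub>1 0 = 0" by simp_all
      ultimately show ?thesis unfolding N_iff by (intro exI[of _ 0]) simp
    qed
  next
    fix x y x' y' assume "(x, y) \<in> N" "(x', y') \<in> N"
    then obtain f v f' v' where f: "(f, \<mu> *\<^sub>C f) \<in> adjoint_op S" "y = \<Gamma>\<^sub>0 f" "(y, v) \<in> T" "x = \<Gamma>\<^sub>1 f - v"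
      and f': "(f', \<mu> *\<^sub>C f') \<in> adjoint_op S" "y' = \<Gamma>\<^sub>0 f'" "(y', v') \<in> T" "x' = \<Gamma>\<^sub>1 f' - v'"
      unfolding N_iff by blast
    have "(f + f', \<mu> *\<^sub>C (f + f')) \<in> adjoint_op S"
      using adjoint_op_add[OF f(1) f'(1)] by (simp add: algebra_simps)
    then show "(x + x', y + y') \<in> N"
      unfolding N_iff using T_add[OF f(3) f'(3)] f f' \<Gamma>_add[OF f(1) f'(1)]
      by (intro exI[of _ "f + f'"] exI[of _ "v + v'"]) simp
  next
    fix c x y assume "(x, y) \<in> N"
    then obtain f v where f: "(f, \<mu> *\<^sub>C f) \<in> adjoint_op S" "y = \<Gamma>\<^sub>0 f" "(y, v) \<in> T" "x = \<Gamma>\<^sub>1 f - v"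
      unfolding N_iff by blast
    have "(c *\<^sub>C f, \<mu> *\<^sub>C (c *\<^sub>C f)) \<in> adjoint_op S"
      using adjoint_op_scaleC[OF f(1), of c] by (simp add: mult.commute)
    then show "(c *\<^sub>C x, c *\<^sub>C y) \<in> N"
      unfolding N_iff using T_scale[OF f(3), of c] f \<Gamma>_scaleC[OF f(1), of c]
      by (intro exI[of _ "c *\<^sub>C f"] exI[of _ "c *\<^sub>C v"]) (simp add: scaleC.scale_right_diff_distrib)
  qed (rule N_sv)
  obtain F where F: "resolvent A \<mu> = op_graph F" "\<And>x y. (x, y + \<mu> *\<^sub>C x) \<in> A \<longleftrightarrow> x = F y"
    using \<mu>(1) by (rule resolvent_setE) blast
  obtain G where G: "resolvent A\<^sub>0 \<mu> = op_graph G" "\<And>x y. (x, y + \<mu> *\<^sub>C x) \<in> A\<^sub>0 \<longleftrightarrow> x = G y"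
    using \<mu>(2) by (rule resolvent_setE) blast
  let ?P = "gamma_field S \<Gamma>\<^sub>0 \<mu> \<odot> N \<odot> adjoint_op (gamma_field S \<Gamma>\<^sub>0 (cnj \<mu>))"
  note adj = adjoint_gamma_field[OF \<mu>(2) G(2)]
  \<comment> \<open>The composite relation is the graph of the difference of the two resolvents; its
    totality is part of the claim.\<close>
  have P: "(y, f) \<in> ?P \<longleftrightarrow> f = G y - F y" for y f
  proof -
    define h k where "h = G y" and "k = F y"
    have h: "(h, y + \<mu> *\<^sub>C h) \<in> adjoint_op S" "\<Gamma>\<^sub>0 h = 0"
      using G(2)[of h y] by (auto simp: A\<^sub>0_def h_def)
    have k: "(k, y + \<mu> *\<^sub>C k) \<in> adjoint_op S" "(\<Gamma>\<^sub>0 k, \<Gamma>\<^sub>1 k) \<in> T"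
      using F(2)[of k y] A by (auto simp: k_def)
    have eig: "(h - k, \<mu> *\<^sub>C (h - k)) \<in> adjoint_op S"
      using adjoint_op_diff[OF h(1) k(1)] by (simp add: algebra_simps)
    \<comment> \<open>As \<open>\<Gamma>\<^sub>0 h = 0\<close>, this is -1 times the boundary pair
      of \<open>k\<close>.\<close>
    have "(\<Gamma>\<^sub>0 (h - k), - \<Gamma>\<^sub>1 k) \<in> T"
      using T_scale[OF k(2), of "-1"] by (simp add: \<Gamma>_diff[OF h(1) k(1)] h(2))
    then have "(\<Gamma>\<^sub>1 h, \<Gamma>\<^sub>0 (h - k)) \<in> N"
      unfolding N_iff using eig \<Gamma>_diff(2)[OF h(1) k(1)]
      by (intro exI[of _ "h - k"] exI[of _ "- \<Gamma>\<^sub>1 k"]) simp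
    moreover have "(\<Gamma>\<^sub>0 (h - k), h - k) \<in> gamma_field S \<Gamma>\<^sub>0 \<mu>"
      using eig by (simp add: gamma_field_iff)
    \<comment> \<open>The pairs just built give existence; single-valuedness of each factor gives
      uniqueness.\<close>
    ultimately show ?thesis
      unfolding adj h_def[symmetric] k_def[symmetric] relcomp_unfold mem_Collect_eq
        case_prod_conv op_graph_iff
      using N_sv \<gamma>_sv by (metis h_def)
  qed
  show "resolvent A \<mu> = resolvent A\<^sub>0 \<mu> \<ominus> ?P"
    unfolding F(1) G(1) by (auto simp: op_minus_def P op_graph_def[of F] simp del: relcomp_unfold)
qed

end

theorem proposition2p19:
  fixes J R :: "'a::complex_hilbert_space \<Rightarrow> 'a"
    and S A A\<^sub>0 :: "('a \<times> 'a) set"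
    and \<Gamma>\<^sub>0 \<Gamma>\<^sub>1 :: "'a \<Rightarrow> 'h::complex_hilbert_space"
    and \<J>\<^sub>\<alpha> U :: "'h \<Rightarrow> 'h"
    and T :: "('h \<times> 'h) set"
    and \<alpha> :: "real^3"
    and \<mu> :: complex
  assumes "nontrivial_symmetry J" and "nontrivial_symmetry R" and "anticommuting J R"
    and "linear_operator S" and "closed S" and "densely_defined S" and "symmetric_op S"
    and "equal_deficiency_indices S"
    and "S \<odot> op_graph J = op_graph J \<odot> S" and "S \<odot> op_graph R = op_graph R \<odot> S"
    and "boundary_triplet S \<Gamma>\<^sub>0 \<Gamma>\<^sub>1" and "compatible_triplet J R S \<Gamma>\<^sub>0 \<Gamma>\<^sub>1"
    and "\<alpha> \<in> sphere 0 1"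
    and "\<J>\<^sub>\<alpha> = clifford_symmetry (boundary_symmetry S \<Gamma>\<^sub>0 \<Gamma>\<^sub>1 J) (boundary_symmetry S \<Gamma>\<^sub>0 \<Gamma>\<^sub>1 R) \<alpha>"
    and "unitary U"
    and "A \<in> krein_extensions (clifford_symmetry J R \<alpha>) S"
    and "A = {(f, g) \<in> adjoint_op S.
          U (\<J>\<^sub>\<alpha> (\<Gamma>\<^sub>1 f) + \<i> *\<^sub>C \<Gamma>\<^sub>0 f) = \<J>\<^sub>\<alpha> (\<Gamma>\<^sub>1 f) - \<i> *\<^sub>C \<Gamma>\<^sub>0 f}"
    and "A\<^sub>0 = {(f, g) \<in> adjoint_op S. \<Gamma>\<^sub>0 f = 0}"
    and "Domain A \<inter> Domain A\<^sub>0 = Domain S"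
    and "\<mu> \<in> resolvent_set A \<inter> resolvent_set A\<^sub>0"
    and "T = op_graph (\<lambda>x. \<i> *\<^sub>C \<J>\<^sub>\<alpha> (x + U x)) \<odot> (op_graph (\<lambda>x. x - U x))\<inverse>"
  shows "krein_self_adjoint \<J>\<^sub>\<alpha> T
    \<and> linear_operator ((weyl_function S \<Gamma>\<^sub>0 \<Gamma>\<^sub>1 \<mu> \<ominus> T)\<inverse>)
    \<and> resolvent A \<mu> = resolvent A\<^sub>0 \<mu> \<ominus>
        gamma_field S \<Gamma>\<^sub>0 \<mu> \<odot> (weyl_function S \<Gamma>\<^sub>0 \<Gamma>\<^sub>1 \<mu> \<ominus> T)\<inverse> \<odot> adjoint_op (gamma_field S \<Gamma>\<^sub>0 (cnj \<mu>))"
proof -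
  note A_def = assms(17) and A0_def = assms(18) and disjoint = assms(19) and T_def = assms(21)
  interpret B: boundary_triplet_space S \<Gamma>\<^sub>0 \<Gamma>\<^sub>1 by unfold_locales (fact assms)+
  have A0: "A\<^sub>0 = B.A\<^sub>0" by (simp add: A0_def B.A\<^sub>0_def)
  have K: "fundamental_symmetry \<J>\<^sub>\<alpha>"
    unfolding assms(14) by (intro fundamental_symmetry_boundary_clifford[of J R]) (fact assms)+
  have T_iff: "(u, v) \<in> T \<longleftrightarrow> U (\<J>\<^sub>\<alpha> v + \<i> *\<^sub>C u) = \<J>\<^sub>\<alpha> v - \<i> *\<^sub>C u" for u v
    unfolding T_def by (rule krein_cayley_iff[OF assms(15) K])
  have "x = 0" if "U x = x" for x
  proof -
    \<comment> \<open>For these boundary values the condition defining \<open>A\<close> reduces to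
      \<open>U x = x\<close>, because \<open>\<J>\<^sub>\<alpha>\<close> is an involution; so
      \<open>f\<close> lies in both domains.\<close>
    obtain f f' where f: "(f, f') \<in> adjoint_op S" "\<Gamma>\<^sub>0 f = 0" "\<Gamma>\<^sub>1 f = \<J>\<^sub>\<alpha> x" by (rule B.\<Gamma>_surj)
    have "(f, f') \<in> A" "(f, f') \<in> A\<^sub>0"
      using f that by (simp_all add: A_def A0_def fundamental_symmetryD(3)[OF K])
    then have "f \<in> Domain S" using disjoint by blast
    then have "\<J>\<^sub>\<alpha> x = 0" using B.\<Gamma>_eq_0_on_S(2) f(3) by fastforce
    then show ?thesis
      using fundamental_symmetryD(3)[OF K, of x] fundamental_symmetry_linear(5)[OF K] by simp
  qed
  then have T: "krein_self_adjoint \<J>\<^sub>\<alpha> T"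
    unfolding T_def by (intro krein_self_adjoint_cayley assms(15) K)
  then have lin: "linear_operator T" by (simp add: krein_self_adjoint_def)
  have A: "(f, g) \<in> A \<longleftrightarrow> (f, g) \<in> adjoint_op S \<and> (\<Gamma>\<^sub>0 f, \<Gamma>\<^sub>1 f) \<in> T" for f g
    by (simp add: A_def T_iff)
  show ?thesis
    using T B.krein_resolvent_formula[OF lin A, of \<mu>] assms(20) by (simp add: A0)
qed

end
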